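(* Let $R$ be a 2-dimensional ADE singularity, so that $R$ is a ring of the form $k[[x,y,z]]/(z^2+g(x,y))$ where $k$ is a field and $g(x,y)\in k[[x,y]]$. Let $M$ be a maximal Cohen-Macaulay $R$-module, that is, a cokernel of a matrix of the form $zI_n-\varphi$ where $\varphi$ is an $n\times n$ square matrix with entries in $(x,y)k[[x,y]]$ and $I_n$ is the $n\times n$ identity matrix. Then $R$ is not $\mathrm{cl}_M$-rational.
   Context: 2-dimensional ADE singularities are the hypersurfaces $k[[x,y,z]]/(z^2+g(x,y))$ with $g$ one of: $x^2+y^{m+1}$ ($A_m$, $m\ge1$); $x^2y+y^{m-1}$ ($D_m$, $m\geq 4$); $x^3+y^4$ ($E_6$); $x^3+xy^3$ ($E_7$); $x^3+y^5$ ($E_8$). Module closure: for an $R$-module $B$ and $R$-modules $L\subseteq N$, $L_N^{\mathrm{cl}_B}=\{u\in N\mid b\otimes u\in\operatorname{im}(B\otimes_R L\to B\otimes_R N)\text{ for all } b\in B\}$. $\mathrm{cl}$-rationality: let $(R,\mathfrak{m},k)$ be a Cohen-Macaulay complete local ring with canonical module $\omega$ and Krull dimension $d$, and let $E=E_R(k)$ be the injective hull of the residue field. Identify $\omega\cong\operatorname{Hom}_R(H^d_{\mathfrak{m}}(R),E)$. For a closure operation $\mathrm{cl}$ on $R$-modules, set $\tau_{\mathrm{cl}}(\omega)=\{f\in\operatorname{Hom}_R(H^d_{\mathfrak{m}}(R),E)\mid f(0^{\mathrm{cl}}_{H^d_{\mathfrak{m}}(R)})=0\}$. Then $R$ is $\mathrm{cl}$-rational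 if $\tau_{\mathrm{cl}}(\omega)=\omega$. (For the ring $R$ of the claim the Krull dimension is $d=2$.) *)

theory Defs
  imports
    "HOL-Algebra.Algebra"
    "HOL-Algebra.Algebraic_Closure_Type"
    "HOL-Algebra.Free_Abelian_Groups"
    "HOL-Computational_Algebra.Formal_Power_Series"
    "HOL-Library.Extended_Nat"
    "Jordan_Normal_Form.Matrix"
begin

section \<open>Modules over a commutative ring\<close>

definition mod_hom ::
  "('a, 'r) ring_scheme \<Rightarrow> ('a, 'b, 'm) module_scheme \<Rightarrow> ('a, 'c, 'n) module_scheme \<Rightarrow> ('b \<Rightarrow> 'c) set"
  where "mod_hom R M N =
    {f \<in> carrier M \<rightarrow> carrier N.
       (\<forall>u\<in>carrier M. \<forall>v\<in>carrier M. f (u \<oplus>\<^bsub>M\<^esub> v) = f u \<oplus>\<^bsub>N\<^esub> f v) \<and>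
       (\<forall>a\<in>carrier R. \<forall>u\<in>carrier M. f (a \<odot>\<^bsub>M\<^esub> u) = a \<odot>\<^bsub>N\<^esub> f u)}"

definition mod_ker ::
  "('a, 'b, 'm) module_scheme \<Rightarrow> ('a, 'c, 'n) module_scheme \<Rightarrow> ('b \<Rightarrow> 'c) \<Rightarrow> 'b set"
  where "mod_ker M N f = {u \<in> carrier M. f u = \<zero>\<^bsub>N\<^esub>}"

definition regular_module :: "('a, 'r) ring_scheme \<Rightarrow> ('a, 'a) module"
  where "regular_module R =
    \<lparr>carrier = carrier R, monoid.mult = monoid.mult R, one = one R,
     ring.zero = ring.zero R, ring.add = ring.add R,
     module.smult = monoid.mult R\<rparr>"

text \<open>The fields \<open>mult\<close> and \<open>one\<close>, which the record type of modules inherits from rings, carry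
  no meaning in a module.\<close>

definition quotient_module :: "('a, 'b, 'm) module_scheme \<Rightarrow> 'b set \<Rightarrow> ('a, 'b set) module"
  where "quotient_module M L =
    \<lparr>carrier = a_rcosets\<^bsub>M\<^esub> L, monoid.mult = undefined, one = undefined, ring.zero = L,
     ring.add = (\<lambda>U V. U <+>\<^bsub>M\<^esub> V), module.smult = (\<lambda>a U. \<Union>u\<in>U. L +>\<^bsub>M\<^esub> (a \<odot>\<^bsub>M\<^esub> u))\<rparr>"

definition free_module :: "('a, 'r) ring_scheme \<Rightarrow> nat \<Rightarrow> ('a, 'a vec) module"
  where "free_module R n =
    \<lparr>carrier = {v \<in> carrier_vec n. \<forall>i<n. v $ i \<in> carrier R},
     monoid.mult = undefined, one = undefined,
     ring.zero = vec n (\<lambda>i. \<zero>\<^bsub>R\<^esub>),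
     ring.add = (\<lambda>v w. vec n (\<lambda>i. v $ i \<oplus>\<^bsub>R\<^esub> w $ i)),
     module.smult = (\<lambda>a v. vec n (\<lambda>i. a \<otimes>\<^bsub>R\<^esub> v $ i))\<rparr>"

definition matrix_map :: "('a, 'r) ring_scheme \<Rightarrow> 'a mat \<Rightarrow> 'a vec \<Rightarrow> 'a vec"
  where "matrix_map R A v =
    vec (dim_row A) (\<lambda>i. \<Oplus>\<^bsub>R\<^esub>j\<in>{..<dim_col A}. A $$ (i, j) \<otimes>\<^bsub>R\<^esub> v $ j)"

text \<open>\<open>M\<close> is a cokernel of \<open>A : R\<^sup>n \<rightarrow> R\<^sup>n\<close>: there is an exact sequence
  \<open>R\<^sup>n \<rightarrow> R\<^sup>n \<rightarrow> M \<rightarrow> 0\<close> with first map \<open>A\<close>.\<close>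

definition is_matrix_cokernel ::
  "('a, 'r) ring_scheme \<Rightarrow> nat \<Rightarrow> 'a mat \<Rightarrow> ('a, 'b, 'm) module_scheme \<Rightarrow> bool"
  where "is_matrix_cokernel R n A M \<longleftrightarrow>
    (\<exists>p \<in> mod_hom R (free_module R n) M.
       p ` carrier (free_module R n) = carrier M \<and>
       mod_ker (free_module R n) M p = matrix_map R A ` carrier (free_module R n))"

section \<open>Maximal Cohen-Macaulay modules\<close>

definition krull_dim :: "('a, 'r) ring_scheme \<Rightarrow> enat"
  where "krull_dim R =
    Sup {enat n | n. \<exists>P. (\<forall>i\<le>n. primeideal (P i) R) \<and> (\<forall>i<n. P i \<subset> P (Suc i))}"

definition fin_gen_module :: "('a, 'r) ring_scheme \<Rightarrow> ('a, 'b, 'm) module_scheme \<Rightarrow> bool"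
  where "fin_gen_module R M \<longleftrightarrow>
    (\<exists>S. finite S \<and> S \<subseteq> carrier M \<and> (\<forall>L. submodule L R M \<and> S \<subseteq> L \<longrightarrow> L = carrier M))"

text \<open>The submodule \<open>(A)M\<close> generated by all products \<open>a v\<close> with \<open>a \<in> A\<close> and \<open>v \<in> M\<close>.\<close>

definition set_smult :: "'a set \<Rightarrow> ('a, 'b, 'm) module_scheme \<Rightarrow> 'b set"
  where "set_smult A M = generate (add_monoid M) {a \<odot>\<^bsub>M\<^esub> v | a v. a \<in> A \<and> v \<in> carrier M}"

text \<open>The second conjunct says that \<open>xs ! i\<close> is a nonzerodivisor on
  \<open>M / (xs ! 0, \<dots>, xs ! (i - 1)) M\<close>.\<close>

definition regular_sequence :: "('a, 'b, 'm) module_scheme \<Rightarrow> 'a list \<Rightarrow> bool"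
  where "regular_sequence M xs \<longleftrightarrow>
    set_smult (set xs) M \<noteq> carrier M \<and>
    (\<forall>i<length xs. \<forall>v\<in>carrier M.
       (xs ! i) \<odot>\<^bsub>M\<^esub> v \<in> set_smult (set (take i xs)) M \<longrightarrow> v \<in> set_smult (set (take i xs)) M)"

definition module_depth :: "'a set \<Rightarrow> ('a, 'b, 'm) module_scheme \<Rightarrow> enat"
  where "module_depth \<mm> M = Sup {enat (length xs) | xs. set xs \<subseteq> \<mm> \<and> regular_sequence M xs}"

definition maximal_CM_module ::
  "('a, 'r) ring_scheme \<Rightarrow> 'a set \<Rightarrow> ('a, 'b, 'm) module_scheme \<Rightarrow> bool"
  where "maximal_CM_module R \<mm> M \<longleftrightarrow>
    module R M \<and> fin_gen_module R M \<and> module_depth \<mm> M = krull_dim R"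

section \<open>Injective modules, injective hulls and local cohomology\<close>

text \<open>A definition cannot quantify over types, so the test modules \<open>N\<close> are those carried by
  the element type of \<open>R\<close>. These include \<open>R\<close> itself, hence by Baer's criterion the extension
  property for them is equivalent to the one for all \<open>R\<close>-modules.\<close>

definition injective_module :: "('a, 'r) ring_scheme \<Rightarrow> ('a, 'b, 'm) module_scheme \<Rightarrow> bool"
  where "injective_module R E \<longleftrightarrow> module R E \<and>
    (\<forall>(N :: ('a, 'a) module) L f.
       module R N \<and> submodule L R N \<and> f \<in> mod_hom R (N\<lparr>carrier := L\<rparr>) E \<longrightarrow>
       (\<exists>h \<in> mod_hom R N E. \<forall>u\<in>L. h u = f u))"

text \<open>\<open>E\<close> with the embedding \<open>\<iota> : N \<rightarrow> E\<close> is an injective essential extension of \<open>N\<close>.\<close>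

definition injective_hull ::
  "('a, 'r) ring_scheme \<Rightarrow> ('a, 'b, 'm) module_scheme \<Rightarrow> ('a, 'e, 'n) module_scheme \<Rightarrow> ('b \<Rightarrow> 'e) \<Rightarrow> bool"
  where "injective_hull R N E \<iota> \<longleftrightarrow>
    injective_module R E \<and> \<iota> \<in> mod_hom R N E \<and> inj_on \<iota> (carrier N) \<and>
    (\<forall>L. submodule L R E \<and> L \<noteq> {\<zero>\<^bsub>E\<^esub>} \<longrightarrow> L \<inter> \<iota> ` carrier N \<noteq> {\<zero>\<^bsub>E\<^esub>})"

definition residue_module :: "('a, 'r) ring_scheme \<Rightarrow> 'a set \<Rightarrow> ('a, 'a set) module"
  where "residue_module R \<mm> = quotient_module (regular_module R) \<mm>"

text \<open>\<open>0 \<rightarrow> N \<rightarrow> I 0 \<rightarrow> I 1 \<rightarrow> \<dots>\<close> with augmentation \<open>\<epsilon>\<close> and differentials \<open>\<delta> n : I n \<rightarrow> I (n + 1)\<close>.\<close>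

definition injective_resolution ::
  "('a, 'r) ring_scheme \<Rightarrow> ('a, 'b, 'm) module_scheme \<Rightarrow>
    (nat \<Rightarrow> ('a, 'c) module) \<Rightarrow> ('b \<Rightarrow> 'c) \<Rightarrow> (nat \<Rightarrow> 'c \<Rightarrow> 'c) \<Rightarrow> bool"
  where "injective_resolution R N I \<epsilon> \<delta> \<longleftrightarrow>
    (\<forall>n. injective_module R (I n)) \<and>
    \<epsilon> \<in> mod_hom R N (I 0) \<and> (\<forall>n. \<delta> n \<in> mod_hom R (I n) (I (Suc n))) \<and>
    inj_on \<epsilon> (carrier N) \<and>
    \<epsilon> ` carrier N = mod_ker (I 0) (I 1) (\<delta> 0) \<and>
    (\<forall>n. \<delta> n ` carrier (I n) = mod_ker (I (Suc n)) (I (Suc (Suc n))) (\<delta> (Suc n)))"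

primrec ideal_power :: "('a, 'r) ring_scheme \<Rightarrow> 'a set \<Rightarrow> nat \<Rightarrow> 'a set"
  where
    "ideal_power R J 0 = carrier R"
  | "ideal_power R J (Suc t) = ideal_prod R J (ideal_power R J t)"

definition torsion_part ::
  "('a, 'r) ring_scheme \<Rightarrow> 'a set \<Rightarrow> ('a, 'b, 'm) module_scheme \<Rightarrow> 'b set"
  where "torsion_part R \<mm> N =
    {u \<in> carrier N. \<exists>t. \<forall>a \<in> ideal_power R \<mm> t. a \<odot>\<^bsub>N\<^esub> u = \<zero>\<^bsub>N\<^esub>}"

text \<open>\<open>H\<^sup>i\<^sub>\<mm>\<close> as the \<open>i\<close>-th right derived functor of the \<open>\<mm>\<close>-torsion functor: the
  cohomology in degree \<open>i\<close> of the complex obtained from the injective resolution \<open>(I, \<delta>)\<close>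
  by taking \<open>\<mm>\<close>-torsion.\<close>

definition local_cohomology ::
  "('a, 'r) ring_scheme \<Rightarrow> 'a set \<Rightarrow> (nat \<Rightarrow> ('a, 'c) module) \<Rightarrow> (nat \<Rightarrow> 'c \<Rightarrow> 'c) \<Rightarrow> nat \<Rightarrow>
    ('a, 'c set) module"
  where "local_cohomology R \<mm> I \<delta> i =
    quotient_module
      ((I i)\<lparr>carrier := {u \<in> torsion_part R \<mm> (I i). \<delta> i u = \<zero>\<^bsub>I (Suc i)\<^esub>}\<rparr>)
      (case i of 0 \<Rightarrow> {\<zero>\<^bsub>I 0\<^esub>} | Suc j \<Rightarrow> \<delta> j ` torsion_part R \<mm> (I j))"

section \<open>Module closures and cl-rationality\<close>

text \<open>The additive group of \<open>B \<otimes>\<^sub>R N\<close>: the free abelian group on \<open>B \<times> N\<close> modulo the bilinearity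
  relations. (The group records are multiplicative; their product is addition of formal sums.)\<close>

definition tensor_gens ::
  "('a, 'b, 'm) module_scheme \<Rightarrow> ('a, 'c, 'n) module_scheme \<Rightarrow> ('b \<times> 'c \<Rightarrow>\<^sub>0 int) monoid"
  where "tensor_gens B N = free_Abelian_group (carrier B \<times> carrier N)"

definition tensor_relations ::
  "('a, 'r) ring_scheme \<Rightarrow> ('a, 'b, 'm) module_scheme \<Rightarrow> ('a, 'c, 'n) module_scheme \<Rightarrow>
    ('b \<times> 'c \<Rightarrow>\<^sub>0 int) set"
  where "tensor_relations R B N = generate (tensor_gens B N)
    ({frag_of (b \<oplus>\<^bsub>B\<^esub> b', u) - frag_of (b, u) - frag_of (b', u) | b b' u.
        b \<in> carrier B \<and> b' \<in> carrier B \<and> u \<in> carrier N} \<union>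
     {frag_of (b, u \<oplus>\<^bsub>N\<^esub> u') - frag_of (b, u) - frag_of (b, u') | b u u'.
        b \<in> carrier B \<and> u \<in> carrier N \<and> u' \<in> carrier N} \<union>
     {frag_of (a \<odot>\<^bsub>B\<^esub> b, u) - frag_of (b, a \<odot>\<^bsub>N\<^esub> u) | a b u.
        a \<in> carrier R \<and> b \<in> carrier B \<and> u \<in> carrier N})"

definition tensor_product ::
  "('a, 'r) ring_scheme \<Rightarrow> ('a, 'b, 'm) module_scheme \<Rightarrow> ('a, 'c, 'n) module_scheme \<Rightarrow>
    ('b \<times> 'c \<Rightarrow>\<^sub>0 int) set monoid"
  where "tensor_product R B N = tensor_gens B N Mod tensor_relations R B N"

definition pure_tensor ::
  "('a, 'r) ring_scheme \<Rightarrow> ('a, 'b, 'm) module_scheme \<Rightarrow> ('a, 'c, 'n) module_scheme \<Rightarrow>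
    'b \<Rightarrow> 'c \<Rightarrow> ('b \<times> 'c \<Rightarrow>\<^sub>0 int) set"
  where "pure_tensor R B N b u = tensor_relations R B N #>\<^bsub>tensor_gens B N\<^esub> frag_of (b, u)"

text \<open>The map \<open>B \<otimes> L \<rightarrow> B \<otimes> N\<close> induced by the inclusion of a submodule \<open>L \<subseteq> N\<close>: a coset of the
  relations of \<open>B \<otimes> L\<close> is sent to the coset of the relations of \<open>B \<otimes> N\<close> containing it.\<close>

definition tensor_incl ::
  "('a, 'r) ring_scheme \<Rightarrow> ('a, 'b, 'm) module_scheme \<Rightarrow> ('a, 'c, 'n) module_scheme \<Rightarrow>
    ('b \<times> 'c \<Rightarrow>\<^sub>0 int) set \<Rightarrow> ('b \<times> 'c \<Rightarrow>\<^sub>0 int) set"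
  where "tensor_incl R B N T = tensor_relations R B N <#>\<^bsub>tensor_gens B N\<^esub> T"

definition module_closure ::
  "('a, 'r) ring_scheme \<Rightarrow> ('a, 'b, 'm) module_scheme \<Rightarrow> ('a, 'c, 'n) module_scheme \<Rightarrow> 'c set \<Rightarrow> 'c set"
  where "module_closure R B N L =
    {u \<in> carrier N. \<forall>b\<in>carrier B.
       pure_tensor R B N b u \<in> tensor_incl R B N ` carrier (tensor_product R B (N\<lparr>carrier := L\<rparr>))}"

text \<open>Here \<open>H\<close> and \<open>E\<close> stand for \<open>H\<^sup>d\<^sub>\<mm>(R)\<close> and \<open>E\<^sub>R(k)\<close>, and \<open>cl N L\<close> for the closure of
  \<open>L\<close> in \<open>N\<close>; the canonical module is identified with \<open>mod_hom R H E\<close>.\<close>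

definition tau_cl ::
  "('a, 'r) ring_scheme \<Rightarrow> (('a, 'h) module \<Rightarrow> 'h set \<Rightarrow> 'h set) \<Rightarrow> ('a, 'h) module \<Rightarrow>
    ('a, 'e, 'n) module_scheme \<Rightarrow> ('h \<Rightarrow> 'e) set"
  where "tau_cl R cl H E = {f \<in> mod_hom R H E. \<forall>u \<in> cl H {\<zero>\<^bsub>H\<^esub>}. f u = \<zero>\<^bsub>E\<^esub>}"

definition cl_rational ::
  "('a, 'r) ring_scheme \<Rightarrow> (('a, 'h) module \<Rightarrow> 'h set \<Rightarrow> 'h set) \<Rightarrow> ('a, 'h) module \<Rightarrow>
    ('a, 'e, 'n) module_scheme \<Rightarrow> bool"
  where "cl_rational R cl H E \<longleftrightarrow> tau_cl R cl H E = mod_hom R H E"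

section \<open>Two-dimensional ADE singularities\<close>

text \<open>\<open>k[[x,y]]\<close> is \<open>'k fps fps\<close>, with \<open>x\<close> the inner and \<open>y\<close> the outer variable; \<open>k[[x,y,z]]\<close> is
  \<open>'k fps fps fps\<close>, with \<open>z\<close> the outermost variable and \<open>fps_const\<close> the inclusion of
  \<open>k[[x,y]]\<close>.\<close>

definition var_x :: "'k::field fps fps" where "var_x = fps_const fps_X"
definition var_y :: "'k::field fps fps" where "var_y = fps_X"
definition var_z :: "'k::field fps fps fps" where "var_z = fps_X"

definition ADE_equation :: "'k::field fps fps \<Rightarrow> bool"
  where "ADE_equation g \<longleftrightarrow>
    (\<exists>m\<ge>1. g = var_x ^ 2 + var_y ^ (m + 1)) \<or>
    (\<exists>m\<ge>4. g = var_x ^ 2 * var_y + var_y ^ (m - 1)) \<or>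
    g = var_x ^ 3 + var_y ^ 4 \<or>
    g = var_x ^ 3 + var_x * var_y ^ 3 \<or>
    g = var_x ^ 3 + var_y ^ 5"

definition hypersurface_ideal :: "'k::field fps fps \<Rightarrow> 'k fps fps fps set"
  where "hypersurface_ideal g = PIdl\<^bsub>ring_of_type_algebra\<^esub> (var_z ^ 2 + fps_const g)"

definition hypersurface_ring :: "'k::field fps fps \<Rightarrow> 'k fps fps fps set ring"
  where "hypersurface_ring g = ring_of_type_algebra Quot hypersurface_ideal g"

definition residue_class :: "'k::field fps fps \<Rightarrow> 'k fps fps fps \<Rightarrow> 'k fps fps fps set"
  where "residue_class g p = hypersurface_ideal g +>\<^bsub>ring_of_type_algebra\<^esub> p"

definition z_minus :: "'k::field fps fps \<Rightarrow> nat \<Rightarrow> 'k fps fps mat \<Rightarrow> 'k fps fps fps set mat"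
  where "z_minus g n \<phi> = map_mat (residue_class g) (var_z \<cdot>\<^sub>m 1\<^sub>m n - map_mat fps_const \<phi>)"

definition ideal_xy :: "'k::field fps fps set"
  where "ideal_xy = Idl\<^bsub>ring_of_type_algebra\<^esub> {var_x, var_y}"

end

theory Submission
  imports Defs
begin

text \<open>The point is that \<open>z M \<subseteq> (x, y) M\<close>, because \<open>z\<close> acts on the generators of \<open>M\<close> through
  \<open>\<phi>\<close>. So if \<open>\<eta> \<in> H\<^sup>2\<^sub>\<mm>(R)\<close> is killed by \<open>x\<close> and \<open>y\<close>, then \<open>b \<otimes> z \<eta> = z b \<otimes> \<eta> = 0\<close> for all
  \<open>b \<in> M\<close>, that is, \<open>z \<eta>\<close> lies in the closure of \<open>0\<close>. For \<open>\<eta> = [1 / (x y)]\<close> one has \<open>z \<eta> \<noteq> 0\<close>,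
  because \<open>R\<close> is free over \<open>k[[x, y]]\<close> with basis \<open>1, z\<close> and \<open>(x y)\<^sup>N\<close> is not in the ideal
  \<open>(x\<^bsup>N+1\<^esup>, y\<^bsup>N+1\<^esup>)\<close>. Since \<open>\<mm>\<close> annihilates \<open>z \<eta>\<close>, Baer's criterion gives a homomorphism to
  the injective hull \<open>E\<close> of the residue field that does not vanish at \<open>z \<eta>\<close>.\<close>

text \<open>The resolution is arbitrary, so no Cech complex is at hand: the class [1 / (x y)] has to
  be built inside it, by division in the first two injective modules. The divisions are possible
  because x, y is a regular sequence on R. Nonvanishing is checked by chasing a hypothetical torsion
  preimage back to a forbidden equation in R. The element z serves as multiplier because it lies in
  the maximal ideal but not in (x, y): it pushes M into (x, y) M without killing the class. That the
  class is torsion at all rests on z^2 = - g with g in (x, y), which puts the square of the maximal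
  ideal into (x, y). Injectivity is only given for test modules carried by the element type of R,
  while local cohomology is carried by another type. The homomorphism to E therefore needs Baer's
  criterion in full, including the Zorn argument.\<close>

no_notation vec_index (infixl "$" 100)

section \<open>Divisibility by the equation of the hypersurface\<close>

lemma fps_const_dvd_iff:
  fixes c :: "'a::idom"
  shows "fps_const c dvd p \<longleftrightarrow> (\<forall>n. c dvd p $ n)"
proof
  assume "\<forall>n. c dvd p $ n"
  then obtain q where "\<And>n. p $ n = c * q n" unfolding dvd_def by metis
  then have "p = fps_const c * Abs_fps q" by (simp add: fps_eq_iff)
  then show "fps_const c dvd p" by simp
qed auto

text \<open>Gauss's argument from the bottom: if \<open>c\<close> divides neither \<open>p\<close>
  nor \<open>q\<close>, let \<open>i\<close> and \<open>j\<close> be the first indices of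
  coefficients not divisible by \<open>c\<close>. In the coefficient of index \<open>i + j\<close>
  of the product, every term except \<open>p $ i * q $ j\<close> has a factor of lower index and is
  divisible by \<open>c\<close>.\<close>

lemma prime_elem_fps_const:
  fixes c :: "'a::idom"
  assumes "prime_elem c"
  shows "prime_elem (fps_const c)"
proof (rule prime_elemI)
  show "fps_const c \<noteq> 0" using assms by auto
  show "\<not> fps_const c dvd 1"
    using assms fps_const_dvd_iff[of c 1] by (metis fps_one_nth prime_elem_not_unit)
  fix p q assume pq: "fps_const c dvd p * q"
  show "fps_const c dvd p \<or> fps_const c dvd q"
  proof (rule ccontr)
    assume "\<not> ?thesis"
    then have ex: "\<exists>n. \<not> c dvd p $ n" "\<exists>n. \<not> c dvd q $ n"
      by (auto simp: fps_const_dvd_iff)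
    define i where "i = (LEAST n. \<not> c dvd p $ n)"
    define j where "j = (LEAST n. \<not> c dvd q $ n)"
    have i: "\<not> c dvd p $ i" "\<And>n. n < i \<Longrightarrow> c dvd p $ n"
      unfolding i_def using LeastI_ex[OF ex(1)] not_less_Least by blast+
    have j: "\<not> c dvd q $ j" "\<And>n. n < j \<Longrightarrow> c dvd q $ n"
      unfolding j_def using LeastI_ex[OF ex(2)] not_less_Least by blast+
    have "(p * q) $ (i + j) = p $ i * q $ j + (\<Sum>l\<in>{0..i + j} - {i}. p $ l * q $ (i + j - l))"
      unfolding fps_mult_nth by (subst sum.remove[of _ i]) auto
    moreover have "c dvd (\<Sum>l\<in>{0..i + j} - {i}. p $ l * q $ (i + j - l))"
    proof (rule dvd_sum)
      fix l assume "l \<in> {0..i + j} - {i}"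
      then have "l < i \<or> i + j - l < j" by auto
      then show "c dvd p $ l * q $ (i + j - l)" using i j by auto
    qed
    moreover have "c dvd (p * q) $ (i + j)" using pq by (simp add: fps_const_dvd_iff)
    ultimately have "c dvd p $ i * q $ j" by (simp add: dvd_add_left_iff)
    then show False using i(1) j(1) assms prime_elem_dvd_multD by blast
  qed
qed

lemma fps_X_dvd_iff:
  fixes p :: "'a::idom fps"
  shows "fps_X dvd p \<longleftrightarrow> p $ 0 = 0"
proof
  assume "p $ 0 = 0"
  then have "p = fps_X * fps_shift 1 p" by (auto simp: fps_eq_iff)
  then show "fps_X dvd p" by (rule dvdI)
qed auto

lemma prime_elem_fps_X: "prime_elem (fps_X :: 'a::idom fps)"
  by (rule prime_elemI) (auto simp: fps_X_dvd_iff)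

section \<open>Coefficients and decompositions in k[[x,y,z]]\<close>

abbreviation (input) "var_x' \<equiv> fps_const var_x"
abbreviation (input) "var_y' \<equiv> fps_const var_y"
abbreviation (input) "hyp_poly g \<equiv> var_z ^ 2 + fps_const g"

lemma prime_elem_X: "prime_elem (var_x' :: 'k::field fps fps fps)"
  unfolding var_x_def by (intro prime_elem_fps_const prime_elem_fps_X)

text \<open>Index order: \<open>p $ n $ j $ i\<close> is the coefficient of z^n y^j x^i, because z
  is the outermost variable and x the innermost.\<close>

lemma X_mult_nth: "(var_x' * p) $ n $ j $ i = (if i = 0 then 0 else p $ n $ j $ (i - 1))"
  by (simp add: var_x_def)

lemma Y_mult_nth: "(var_y' * p) $ n $ j $ i = (if j = 0 then 0 else p $ n $ (j - 1) $ i)"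
  by (simp add: var_y_def)

lemma X_power_mult_nth: "(var_x' ^ N * p) $ n $ j $ i = (if i < N then 0 else p $ n $ j $ (i - N))"
  by (simp add: var_x_def fps_const_power fps_X_power_mult_nth)

lemma Y_power_mult_nth: "(var_y' ^ N * p) $ n $ j $ i = (if j < N then 0 else p $ n $ (j - N) $ i)"
  by (simp add: var_y_def fps_const_power fps_X_power_mult_nth)

text \<open>Read at \<open>n + 2\<close>, the formula expresses \<open>h $ n\<close> through
  \<open>g * h $ (n + 2)\<close>. When g has no constant term, this gains a degree in x and y, which
  drives the divisibility arguments below.\<close>

lemma hyp_poly_mult_nth: "(hyp_poly g * h) $ n = (if n < 2 then 0 else h $ (n - 2)) + g * h $ n"
  unfolding distrib_right by (simp add: var_z_def fps_X_power_mult_nth)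

lemma in_ideal_xy_decomp:
  fixes s :: "'k::field fps fps"
  assumes "s $ 0 $ 0 = 0"
  shows "\<exists>a b. s = var_x * a + var_y * b"
proof -
  have "s = fps_const (s $ 0) + fps_X * fps_shift 1 s"
    by (auto simp: fps_eq_iff)
  moreover have "s $ 0 = fps_X * fps_shift 1 (s $ 0)"
    using assms by (auto simp: fps_eq_iff)
  ultimately have "s = fps_const fps_X * fps_const (fps_shift 1 (s $ 0)) + fps_X * fps_shift 1 s"
    by (metis fps_const_mult)
  then show ?thesis unfolding var_x_def var_y_def by blast
qed

text \<open>The decompositions of the single z-coefficients assemble to power series in z without
  any compatibility condition.\<close>

lemma in_XY_decomp:
  fixes h :: "'k::field fps fps fps"
  assumes "\<And>n. h $ n $ 0 $ 0 = 0"
  shows "\<exists>A B. h = var_x' * A + var_y' * B"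
proof -
  have "\<exists>p. h $ n = var_x * fst p + var_y * snd p" for n
    using in_ideal_xy_decomp[OF assms] by auto
  then obtain ab where "\<And>n. h $ n = var_x * fst (ab n) + var_y * snd (ab n)" by metis
  then have "h = var_x' * Abs_fps (fst \<circ> ab) + var_y' * Abs_fps (snd \<circ> ab)" by (simp add: fps_eq_iff)
  then show ?thesis by blast
qed

section \<open>Regularity of x, y modulo the equation\<close>

lemma X_not_dvd_hyp_poly: "\<not> (var_x' :: 'k::field fps fps fps) dvd hyp_poly g"
proof
  assume "(var_x' :: 'k fps fps fps) dvd hyp_poly g"
  then obtain q where "hyp_poly g = var_x' * q" by blast
  \<comment> \<open>Compare coefficients of z^2 at x = y = 0: the left side gives 1, the right side
    0. The factor 1 supplies the product that \<open>hyp_poly_mult_nth\<close> expects.\<close>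
  then have "(hyp_poly g * 1) $ 2 $ 0 $ 0 = (var_x' * q) $ 2 $ 0 $ 0" by simp
  then show False by (simp only: hyp_poly_mult_nth X_mult_nth) simp
qed

text \<open>The prime x does not divide the equation, so it divides the cofactor and cancels. In R:
  x is a nonzerodivisor.\<close>

lemma hyp_poly_dvd_X_mult_cancel:
  fixes p :: "'k::field fps fps fps"
  assumes "hyp_poly g dvd var_x' * p"
  shows "hyp_poly g dvd p"
proof -
  from assms obtain h where h: "var_x' * p = hyp_poly g * h" by blast
  then have "var_x' dvd hyp_poly g * h" by (metis dvd_triv_left)
  then obtain q where "h = var_x' * q"
    using prime_elem_X X_not_dvd_hyp_poly prime_elem_dvd_multD by blast
  then have "var_x' * p = var_x' * (hyp_poly g * q)" using h by (simp add: ac_simps)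
  moreover have "(var_x' :: 'k fps fps fps) \<noteq> 0" using prime_elem_X by (rule prime_elem_not_zeroI)
  ultimately have "p = hyp_poly g * q" by (metis mult_left_cancel)
  then show ?thesis by simp
qed

text \<open>Reducing modulo (x, y) leaves 0 = z^2 h, so the cofactor is h = x A + y B. With f the
  equation, its two parts can be sorted to x (r + f A) = y (s - f B), and primality of x yields the
  factor x. In R: y is a nonzerodivisor modulo x.\<close>

lemma hyp_poly_dvd_Y_mult_mod_X:
  fixes r s :: "'k::field fps fps fps"
  assumes g: "g $ 0 $ 0 = 0" and dvd: "hyp_poly g dvd var_y' * s - var_x' * r"
  shows "\<exists>q. hyp_poly g dvd s - var_x' * q"
proof -
  from dvd obtain h where h: "var_y' * s - var_x' * r = hyp_poly g * h" by blast
  have "h $ n $ 0 $ 0 = 0" for n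
  proof -
    have "(hyp_poly g * h) $ (n + 2) $ 0 $ 0 = (var_y' * s - var_x' * r) $ (n + 2) $ 0 $ 0" using h by simp
    then show ?thesis
      using g by (simp only: hyp_poly_mult_nth fps_sub_nth X_mult_nth Y_mult_nth fps_add_nth fps_mult_nth_0) simp
  qed
  then obtain A B where AB: "h = var_x' * A + var_y' * B" using in_XY_decomp by blast
  have eq: "var_x' * (r + hyp_poly g * A) = var_y' * (s - hyp_poly g * B)"
    using h unfolding AB by (simp add: algebra_simps)
  have "\<not> (var_x' :: 'k fps fps fps) dvd var_y'"
  proof
    assume "(var_x' :: 'k fps fps fps) dvd var_y'"
    then obtain q :: "'k fps fps fps" where "var_y' = var_x' * q" by blast
    then have "(var_y' * 1) $ 0 $ 1 $ 0 = (var_x' * q) $ 0 $ 1 $ 0" by simp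
    then show False by (simp only: Y_mult_nth X_mult_nth) simp
  qed
  moreover have "var_x' dvd var_y' * (s - hyp_poly g * B)" using eq by (metis dvd_triv_left)
  ultimately obtain q where "s - hyp_poly g * B = var_x' * q"
    using prime_elem_X prime_elem_dvd_multD by blast
  then have "s - var_x' * q = hyp_poly g * B" by (simp add: algebra_simps)
  then show ?thesis by (metis dvd_triv_left)
qed

text \<open>If \<open>h\<close> were the quotient, the coefficients of \<open>z\<^bsup>n+2\<^esup>\<close> would give \<open>h\<^sub>n = - g h\<^bsub>n+2\<^esub>\<close> modulo
  \<open>(x\<^bsup>N+1\<^esup>, y\<^bsup>N+1\<^esup>)\<close>. Hence all \<open>h\<^sub>n\<close> vanish there, by induction on the total degree in \<open>x, y\<close>,
  while the coefficient of \<open>z\<close> says \<open>g h\<^sub>1 = - (x y)\<^sup>N\<close>.\<close>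

lemma hyp_poly_not_dvd:
  fixes r s :: "'k::field fps fps fps"
  assumes g: "g $ 0 $ 0 = 0"
  shows "\<not> hyp_poly g dvd var_y' ^ Suc N * r - (var_z * (var_x' ^ N * var_y' ^ N) + var_x' ^ Suc N * s)"
proof
  assume "hyp_poly g dvd var_y' ^ Suc N * r - (var_z * (var_x' ^ N * var_y' ^ N) + var_x' ^ Suc N * s)"
  then obtain h where h: "var_y' ^ Suc N * r - (var_z * (var_x' ^ N * var_y' ^ N) + var_x' ^ Suc N * s) = hyp_poly g * h"
    by (rule dvdE)
  \<comment> \<open>For exponents at most N the multiples of x^(N+1) and y^(N+1) contribute nothing,
    so only the monomial z (x y)^N is seen.\<close>
  have low: "(hyp_poly g * h) $ n $ j $ i = - (if n = 1 \<and> i = N \<and> j = N then 1 else 0)"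
    if ij: "i \<le> N" "j \<le> N" for n i j
  proof -
    have "(var_z :: 'k fps fps fps) * (var_x' ^ N * var_y' ^ N) = var_x' ^ N * (var_y' ^ N * var_z)" by (simp add: ac_simps)
    then have "((var_z :: 'k fps fps fps) * (var_x' ^ N * var_y' ^ N)) $ n $ j $ i =
       (if i < N \<or> j < N then 0 else (var_z :: 'k fps fps fps) $ n $ (j - N) $ (i - N))"
      by (simp only: X_power_mult_nth Y_power_mult_nth) simp
    moreover have "(var_z :: 'k fps fps fps) $ n $ j $ i = (if n = 1 \<and> i = 0 \<and> j = 0 then 1 else 0)"
      for n i j by (simp add: var_z_def fps_X_def)
    ultimately show ?thesis unfolding h[symmetric] fps_sub_nth fps_add_nth X_power_mult_nth Y_power_mult_nth
      using ij by auto
  qed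
  \<comment> \<open>As g has no constant term, each possibly nonzero product in the convolution uses
    a coefficient of \<open>t\<close> of strictly smaller total degree.\<close>
  have mult0: "(g * t) $ j $ i = 0" if "\<And>i' j'. \<lbrakk>i' \<le> i; j' \<le> j; i' + j' < i + j\<rbrakk> \<Longrightarrow> t $ j' $ i' = 0"
    for t i j
  proof -
    have "g $ j' $ i' * t $ (j - j') $ (i - i') = 0" if "j' \<le> j" "i' \<le> i" for i' j'
      using that g \<open>\<And>i' j'. _ \<Longrightarrow> _ \<Longrightarrow> _ \<Longrightarrow> t $ j' $ i' = 0\<close>[of "i - i'" "j - j'"]
      by (cases "i' = 0 \<and> j' = 0") auto
    then show ?thesis unfolding fps_mult_nth fps_sum_nth by (intro sum.neutral ballI) simp
  qed
  have zero: "h $ n $ j $ i = 0" if "i \<le> N" "j \<le> N" for n i j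
    using that
  proof (induction "i + j" arbitrary: n i j rule: less_induct)
    case less
    have "(g * h $ (n + 2)) $ j $ i = 0"
      by (rule mult0) (use less in auto)
    moreover have "(hyp_poly g * h) $ (n + 2) $ j $ i = 0" using low[of i j "n + 2"] less by simp
    ultimately show ?case by (simp only: hyp_poly_mult_nth) simp
  qed
  have "(g * h $ 1) $ N $ N = 0" by (rule mult0) (auto simp: zero)
  moreover have "(hyp_poly g * h) $ 1 $ N $ N = -1" using low[of N N 1] by simp
  ultimately show False by (simp only: hyp_poly_mult_nth) simp
qed

section \<open>Baer's criterion\<close>

lemma mod_homD:
  assumes "f \<in> mod_hom R M N"
  shows "u \<in> carrier M \<Longrightarrow> f u \<in> carrier N"
    and "u \<in> carrier M \<Longrightarrow> v \<in> carrier M \<Longrightarrow> f (u \<oplus>\<^bsub>M\<^esub> v) = f u \<oplus>\<^bsub>N\<^esub> f v"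
    and "a \<in> carrier R \<Longrightarrow> u \<in> carrier M \<Longrightarrow> f (a \<odot>\<^bsub>M\<^esub> u) = a \<odot>\<^bsub>N\<^esub> f u"
  using assms by (auto simp: mod_hom_def)

lemma mod_hom_zero:
  assumes f: "f \<in> mod_hom R M N" and "module R M" "module R N"
  shows "f \<zero>\<^bsub>M\<^esub> = \<zero>\<^bsub>N\<^esub>"
proof -
  interpret M: module R M by fact
  interpret N: module R N by fact
  have "f (\<zero>\<^bsub>R\<^esub> \<odot>\<^bsub>M\<^esub> \<zero>\<^bsub>M\<^esub>) = \<zero>\<^bsub>R\<^esub> \<odot>\<^bsub>N\<^esub> f \<zero>\<^bsub>M\<^esub>"
    by (rule mod_homD[OF f]) auto
  then show ?thesis using mod_homD(1)[OF f, of "\<zero>\<^bsub>M\<^esub>"] by simp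
qed

lemma (in abelian_group) minus_zero_imp_eq:
  assumes "x \<ominus> y = \<zero>" "x \<in> carrier G" "y \<in> carrier G"
  shows "x = y"
  using minus_equality[of x "\<ominus> y"] assms by (simp add: a_minus_def)

lemma mod_hom_minus:
  assumes f: "f \<in> mod_hom R M N" and "module R M" "module R N" "u \<in> carrier M" "v \<in> carrier M"
  shows "f (u \<ominus>\<^bsub>M\<^esub> v) = f u \<ominus>\<^bsub>N\<^esub> f v"
proof -
  interpret M: module R M by fact
  interpret N: module R N by fact
  have "f (\<ominus>\<^bsub>M\<^esub> v) \<oplus>\<^bsub>N\<^esub> f v = \<zero>\<^bsub>N\<^esub>"
    using mod_homD(2)[OF f, of "\<ominus>\<^bsub>M\<^esub> v" v] mod_hom_zero[OF assms(1-3)] assms by (simp add: M.l_neg)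
  then have "f (\<ominus>\<^bsub>M\<^esub> v) = \<ominus>\<^bsub>N\<^esub> f v"
    using mod_homD(1)[OF f] assms by (metis M.a_inv_closed N.minus_equality)
  then show ?thesis using mod_homD[OF f] assms by (simp add: a_minus_def)
qed

lemma (in cring) regular_module_module: "module R (regular_module R)"
proof (rule moduleI)
  show "cring R" by (rule is_cring)
  show "abelian_group (regular_module R)"
  proof (rule abelian_groupI)
    fix x assume "x \<in> carrier (regular_module R)"
    then show "\<exists>y\<in>carrier (regular_module R). y \<oplus>\<^bsub>regular_module R\<^esub> x = \<zero>\<^bsub>regular_module R\<^esub>"
      by (intro bexI[of _ "\<ominus> x"]) (auto simp: regular_module_def l_neg)
  qed (auto simp: regular_module_def a_ac)
qed (auto simp: regular_module_def l_distr r_distr m_assoc)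

lemma (in cring) ideal_submodule_regular_module:
  assumes "ideal J R" shows "submodule J R (regular_module R)"
proof -
  interpret ideal J R by fact
  have "subgroup J (add_monoid R)" by (rule a_subgroup)
  then show ?thesis
    by (auto simp: submodule_def submodule_axioms_def regular_module_def subgroup_def m_inv_def I_l_closed)
qed

text \<open>The test module is R itself, so the definition of injectivity applies directly; a
  homomorphism on R is multiplication by its value at 1. All later uses of injectivity go through
  this case.\<close>

lemma injective_module_ideal_extension:
  fixes R :: "('a, 'r) ring_scheme"
  assumes E: "injective_module R E" and J: "ideal J R"
    and f: "\<And>r. r \<in> J \<Longrightarrow> f r \<in> carrier E"
    and add: "\<And>r s. r \<in> J \<Longrightarrow> s \<in> J \<Longrightarrow> f (r \<oplus>\<^bsub>R\<^esub> s) = f r \<oplus>\<^bsub>E\<^esub> f s"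
    and smult: "\<And>a r. a \<in> carrier R \<Longrightarrow> r \<in> J \<Longrightarrow> f (a \<otimes>\<^bsub>R\<^esub> r) = a \<odot>\<^bsub>E\<^esub> f r"
  shows "\<exists>e\<in>carrier E. \<forall>r\<in>J. f r = r \<odot>\<^bsub>E\<^esub> e"
proof -
  interpret E: module R E using E by (simp add: injective_module_def)
  let ?R = "regular_module R"
  have "f \<in> mod_hom R (?R\<lparr>carrier := J\<rparr>) E"
    using f add smult by (auto simp: mod_hom_def regular_module_def)
  then obtain h where h: "h \<in> mod_hom R ?R E" "\<forall>u\<in>J. h u = f u"
    using E E.R.regular_module_module E.R.ideal_submodule_regular_module[OF J]
    unfolding injective_module_def by blast
  have one: "\<one>\<^bsub>R\<^esub> \<in> carrier ?R" by (simp add: regular_module_def)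
  have "f r = r \<odot>\<^bsub>E\<^esub> h \<one>\<^bsub>R\<^esub>" if "r \<in> J" for r
  proof -
    have r: "r \<in> carrier R" using that J by (simp add: ideal.Icarr)
    then have "h r = h (r \<odot>\<^bsub>?R\<^esub> \<one>\<^bsub>R\<^esub>)" by (simp add: regular_module_def)
    also have "\<dots> = r \<odot>\<^bsub>E\<^esub> h \<one>\<^bsub>R\<^esub>" by (rule mod_homD(3)[OF h(1) r one])
    finally show ?thesis using h(2) that by simp
  qed
  then show ?thesis using mod_homD(1)[OF h(1) one] by blast
qed

text \<open>\<open>G\<close> is the graph of a homomorphism to \<open>E\<close> from a submodule of \<open>N\<close>.\<close>

definition partial_hom ::
  "('a, 'r) ring_scheme \<Rightarrow> ('a, 'b, 'm) module_scheme \<Rightarrow> ('a, 'c, 'n) module_scheme \<Rightarrow> ('b \<times> 'c) set \<Rightarrow> bool"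
  where "partial_hom R N E G \<longleftrightarrow>
    G \<subseteq> carrier N \<times> carrier E \<and> (\<zero>\<^bsub>N\<^esub>, \<zero>\<^bsub>E\<^esub>) \<in> G \<and>
    (\<forall>u e u' e'. (u, e) \<in> G \<longrightarrow> (u', e') \<in> G \<longrightarrow> (u \<oplus>\<^bsub>N\<^esub> u', e \<oplus>\<^bsub>E\<^esub> e') \<in> G) \<and>
    (\<forall>a u e. a \<in> carrier R \<longrightarrow> (u, e) \<in> G \<longrightarrow> (a \<odot>\<^bsub>N\<^esub> u, a \<odot>\<^bsub>E\<^esub> e) \<in> G) \<and>
    (\<forall>e. (\<zero>\<^bsub>N\<^esub>, e) \<in> G \<longrightarrow> e = \<zero>\<^bsub>E\<^esub>)"

text \<open>\<open>partial_hom\<close> restricts only the values at 0. Given two values at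
  \<open>u\<close>, subtracting the pairs by means of the scalar -1 turns their difference into a
  value at 0.\<close>

lemma partial_hom_single_valued:
  assumes G: "partial_hom R N E G" and "module R N" "module R E" and ue: "(u, e) \<in> G" "(u, e') \<in> G"
  shows "e = e'"
proof -
  interpret N: module R N by fact
  interpret E: module R E by fact
  have "u \<in> carrier N" and c: "e \<in> carrier E" "e' \<in> carrier E"
    using G ue by (auto simp: partial_hom_def)
  have "(\<ominus>\<^bsub>R\<^esub> \<one>\<^bsub>R\<^esub> \<odot>\<^bsub>N\<^esub> u, \<ominus>\<^bsub>R\<^esub> \<one>\<^bsub>R\<^esub> \<odot>\<^bsub>E\<^esub> e') \<in> G"
    using G ue(2) by (simp add: partial_hom_def)
  then have "(u \<oplus>\<^bsub>N\<^esub> \<ominus>\<^bsub>R\<^esub> \<one>\<^bsub>R\<^esub> \<odot>\<^bsub>N\<^esub> u, e \<oplus>\<^bsub>E\<^esub> \<ominus>\<^bsub>R\<^esub> \<one>\<^bsub>R\<^esub> \<odot>\<^bsub>E\<^esub> e') \<in> G"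
    using G ue(1) by (simp add: partial_hom_def)
  then have "(\<zero>\<^bsub>N\<^esub>, e \<ominus>\<^bsub>E\<^esub> e') \<in> G"
    using \<open>u \<in> carrier N\<close> c by (simp add: N.smult_l_minus E.smult_l_minus N.r_neg a_minus_def)
  then have "e \<ominus>\<^bsub>E\<^esub> e' = \<zero>\<^bsub>E\<^esub>" using G by (simp add: partial_hom_def)
  then show ?thesis by (rule E.M.minus_zero_imp_eq) fact+
qed

text \<open>Baer's step: extending by \<open>h\<close> means choosing its value. The multiples of
  \<open>h\<close> already in the domain prescribe a homomorphism on the ideal \<open>J\<close>, and
  injectivity realises it as multiplication by one element \<open>e1\<close>, which is the value to
  choose.\<close>

lemma partial_hom_extend:
  assumes E: "injective_module R E" and N: "module R N" and G: "partial_hom R N E G"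
    and h: "h \<in> carrier N"
  shows "\<exists>G'. partial_hom R N E G' \<and> G \<subseteq> G' \<and> h \<in> Domain G'"
proof -
  have Em: "module R E" using E by (simp add: injective_module_def)
  interpret N: module R N by fact
  interpret E: module R E by fact
  have Gc: "u \<in> carrier N \<and> e \<in> carrier E" if "(u, e) \<in> G" for u e
    using G that by (auto simp: partial_hom_def)
  have G0: "(\<zero>\<^bsub>N\<^esub>, \<zero>\<^bsub>E\<^esub>) \<in> G" using G by (simp add: partial_hom_def)
  have Ga: "(u \<oplus>\<^bsub>N\<^esub> u', e \<oplus>\<^bsub>E\<^esub> e') \<in> G" if "(u, e) \<in> G" "(u', e') \<in> G" for u e u' e'
    using G that by (simp add: partial_hom_def)
  have Gs: "(a \<odot>\<^bsub>N\<^esub> u, a \<odot>\<^bsub>E\<^esub> e) \<in> G" if "a \<in> carrier R" "(u, e) \<in> G" for a u e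
    using G that by (simp add: partial_hom_def)
  have Gz: "e = \<zero>\<^bsub>E\<^esub>" if "(\<zero>\<^bsub>N\<^esub>, e) \<in> G" for e using G that by (simp add: partial_hom_def)
  define J where "J = {r \<in> carrier R. \<exists>e. (r \<odot>\<^bsub>N\<^esub> h, e) \<in> G}"
  define f where "f r = (THE e. (r \<odot>\<^bsub>N\<^esub> h, e) \<in> G)" for r
  have f_eq: "f r = e" if "(r \<odot>\<^bsub>N\<^esub> h, e) \<in> G" for r e
    unfolding f_def using that partial_hom_single_valued[OF G N Em] by blast
  have fG: "(r \<odot>\<^bsub>N\<^esub> h, f r) \<in> G" if r: "r \<in> J" for r
  proof -
    obtain e where "(r \<odot>\<^bsub>N\<^esub> h, e) \<in> G" using r unfolding J_def by blast
    then show ?thesis using f_eq by simp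
  qed
  have fG_add: "((r \<oplus>\<^bsub>R\<^esub> s) \<odot>\<^bsub>N\<^esub> h, f r \<oplus>\<^bsub>E\<^esub> f s) \<in> G" if "r \<in> J" "s \<in> J" for r s
    using that Ga[OF fG fG, of r s] h by (simp add: J_def N.smult_l_distr)
  have fG_smult: "((a \<otimes>\<^bsub>R\<^esub> r) \<odot>\<^bsub>N\<^esub> h, a \<odot>\<^bsub>E\<^esub> f r) \<in> G" if "a \<in> carrier R" "r \<in> J" for a r
    using that Gs[OF _ fG, of a r] h by (simp add: J_def N.smult_assoc1)
  have J_add: "r \<oplus>\<^bsub>R\<^esub> s \<in> J" if "r \<in> J" "s \<in> J" for r s
    using fG_add that unfolding J_def by blast
  have J_mult: "a \<otimes>\<^bsub>R\<^esub> r \<in> J" if "a \<in> carrier R" "r \<in> J" for a r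
    using fG_smult that unfolding J_def by blast
  have JR: "r \<in> carrier R" if "r \<in> J" for r using that by (simp add: J_def)
  have "ideal J R"
  proof (rule idealI)
    show "subgroup J (add_monoid R)"
    proof (rule N.R.add.subgroupI)
      have "\<zero>\<^bsub>R\<^esub> \<in> J" using G0 h by (auto simp: J_def)
      then show "J \<noteq> {}" by blast
      fix r assume r: "r \<in> J"
      have "\<ominus>\<^bsub>R\<^esub> \<one>\<^bsub>R\<^esub> \<otimes>\<^bsub>R\<^esub> r \<in> J" using r by (intro J_mult) auto
      then show "\<ominus>\<^bsub>R\<^esub> r \<in> J" using JR[OF r] by (simp add: N.R.l_minus)
    qed (use J_add JR in auto)
    show "a \<otimes>\<^bsub>R\<^esub> x \<in> J" if "a \<in> J" "x \<in> carrier R" for a x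
      using J_mult[OF that(2,1)] JR that by (simp add: N.R.m_comm)
  qed (use J_mult N.R.ring_axioms in auto)
  then obtain e1 where e1: "e1 \<in> carrier E" "\<forall>r\<in>J. f r = r \<odot>\<^bsub>E\<^esub> e1"
  proof -
    have "\<exists>e\<in>carrier E. \<forall>r\<in>J. f r = r \<odot>\<^bsub>E\<^esub> e"
    proof (rule injective_module_ideal_extension[OF E])
      show "ideal J R" by fact
      show "f r \<in> carrier E" if "r \<in> J" for r using Gc[OF fG[OF that]] by simp
      show "f (r \<oplus>\<^bsub>R\<^esub> s) = f r \<oplus>\<^bsub>E\<^esub> f s" if "r \<in> J" "s \<in> J" for r s
        using f_eq[OF fG_add[OF that]] .
      show "f (a \<otimes>\<^bsub>R\<^esub> r) = a \<odot>\<^bsub>E\<^esub> f r" if "a \<in> carrier R" "r \<in> J" for a r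
        using f_eq[OF fG_smult[OF that]] .
    qed
    then show ?thesis using that by blast
  qed
  \<comment> \<open>The sum of \<open>G\<close> and the graph of r h |-> r e1; that it is
    single-valued is the last point checked below.\<close>
  define G' where "G' = {(u \<oplus>\<^bsub>N\<^esub> r \<odot>\<^bsub>N\<^esub> h, e \<oplus>\<^bsub>E\<^esub> r \<odot>\<^bsub>E\<^esub> e1) | u e r. (u, e) \<in> G \<and> r \<in> carrier R}"
  have G'I: "(u', e') \<in> G'" if "(u, e) \<in> G" "r \<in> carrier R" "u' = u \<oplus>\<^bsub>N\<^esub> r \<odot>\<^bsub>N\<^esub> h" "e' = e \<oplus>\<^bsub>E\<^esub> r \<odot>\<^bsub>E\<^esub> e1"
    for u e r u' e' using that unfolding G'_def by blast
  have sub: "G \<subseteq> G'"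
  proof clarify
    fix u e assume "(u, e) \<in> G"
    then show "(u, e) \<in> G'" using Gc[of u e] h e1(1) by (intro G'I[of u e "\<zero>\<^bsub>R\<^esub>"]) auto
  qed
  have "(h, e1) \<in> G'" using G0 h e1(1) by (intro G'I[of "\<zero>\<^bsub>N\<^esub>" "\<zero>\<^bsub>E\<^esub>" "\<one>\<^bsub>R\<^esub>"]) auto
  moreover have "partial_hom R N E G'"
    unfolding partial_hom_def
  proof (intro conjI allI impI)
    show "G' \<subseteq> carrier N \<times> carrier E"
    proof
      fix p assume "p \<in> G'"
      then obtain u e r where p: "p = (u \<oplus>\<^bsub>N\<^esub> r \<odot>\<^bsub>N\<^esub> h, e \<oplus>\<^bsub>E\<^esub> r \<odot>\<^bsub>E\<^esub> e1)" "(u, e) \<in> G" "r \<in> carrier R"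
        unfolding G'_def by blast
      then show "p \<in> carrier N \<times> carrier E" using Gc[OF p(2)] h e1(1) by simp
    qed
    show "(\<zero>\<^bsub>N\<^esub>, \<zero>\<^bsub>E\<^esub>) \<in> G'" using sub G0 by blast
  next
    fix u e u' e' assume "(u, e) \<in> G'" "(u', e') \<in> G'"
    then obtain v d r v' d' r' where *: "(v, d) \<in> G" "r \<in> carrier R" "(v', d') \<in> G" "r' \<in> carrier R"
      "u = v \<oplus>\<^bsub>N\<^esub> r \<odot>\<^bsub>N\<^esub> h" "e = d \<oplus>\<^bsub>E\<^esub> r \<odot>\<^bsub>E\<^esub> e1" "u' = v' \<oplus>\<^bsub>N\<^esub> r' \<odot>\<^bsub>N\<^esub> h" "e' = d' \<oplus>\<^bsub>E\<^esub> r' \<odot>\<^bsub>E\<^esub> e1"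
      unfolding G'_def by blast
    have c: "v \<in> carrier N" "d \<in> carrier E" "v' \<in> carrier N" "d' \<in> carrier E"
      using Gc[OF *(1)] Gc[OF *(3)] by auto
    have "u \<oplus>\<^bsub>N\<^esub> u' = (v \<oplus>\<^bsub>N\<^esub> v') \<oplus>\<^bsub>N\<^esub> (r \<oplus>\<^bsub>R\<^esub> r') \<odot>\<^bsub>N\<^esub> h"
      unfolding *(5,7) using c h *(2,4) by (simp add: N.smult_l_distr N.M.a_ac)
    moreover have "e \<oplus>\<^bsub>E\<^esub> e' = (d \<oplus>\<^bsub>E\<^esub> d') \<oplus>\<^bsub>E\<^esub> (r \<oplus>\<^bsub>R\<^esub> r') \<odot>\<^bsub>E\<^esub> e1"
      unfolding *(6,8) using c e1(1) *(2,4) by (simp add: E.smult_l_distr E.M.a_ac)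
    ultimately show "(u \<oplus>\<^bsub>N\<^esub> u', e \<oplus>\<^bsub>E\<^esub> e') \<in> G'"
      using G'I[OF Ga[OF *(1,3)], of "r \<oplus>\<^bsub>R\<^esub> r'"] *(2,4) by simp
  next
    fix a u e assume a: "a \<in> carrier R" and "(u, e) \<in> G'"
    then obtain v d r where *: "(v, d) \<in> G" "r \<in> carrier R"
      "u = v \<oplus>\<^bsub>N\<^esub> r \<odot>\<^bsub>N\<^esub> h" "e = d \<oplus>\<^bsub>E\<^esub> r \<odot>\<^bsub>E\<^esub> e1"
      unfolding G'_def by blast
    have c: "v \<in> carrier N" "d \<in> carrier E" using Gc[OF *(1)] by auto
    have "a \<odot>\<^bsub>N\<^esub> u = a \<odot>\<^bsub>N\<^esub> v \<oplus>\<^bsub>N\<^esub> (a \<otimes>\<^bsub>R\<^esub> r) \<odot>\<^bsub>N\<^esub> h"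
      unfolding *(3) using c h a *(2) by (simp add: N.smult_r_distr N.smult_assoc1)
    moreover have "a \<odot>\<^bsub>E\<^esub> e = a \<odot>\<^bsub>E\<^esub> d \<oplus>\<^bsub>E\<^esub> (a \<otimes>\<^bsub>R\<^esub> r) \<odot>\<^bsub>E\<^esub> e1"
      unfolding *(4) using c e1(1) a *(2) by (simp add: E.smult_r_distr E.smult_assoc1)
    ultimately show "(a \<odot>\<^bsub>N\<^esub> u, a \<odot>\<^bsub>E\<^esub> e) \<in> G'"
      using G'I[OF Gs[OF a *(1)], of "a \<otimes>\<^bsub>R\<^esub> r"] a *(2) by simp
  next
    fix e assume "(\<zero>\<^bsub>N\<^esub>, e) \<in> G'"
    then obtain v d r where *: "(v, d) \<in> G" "r \<in> carrier R"
      "\<zero>\<^bsub>N\<^esub> = v \<oplus>\<^bsub>N\<^esub> r \<odot>\<^bsub>N\<^esub> h" "e = d \<oplus>\<^bsub>E\<^esub> r \<odot>\<^bsub>E\<^esub> e1"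
      unfolding G'_def by blast
    have v: "v \<in> carrier N" using Gc *(1) by blast
    \<comment> \<open>From v + r h = 0 it follows that r h = - v is already in the domain of
      \<open>G\<close>, so r lies in \<open>J\<close> and \<open>G\<close> assigns r e1 to r h.
      Adding the pairs (v, d) and (r h, r e1) gives a value of \<open>G\<close> at 0, which must
      vanish.\<close>
    have "r \<odot>\<^bsub>N\<^esub> h = \<ominus>\<^bsub>N\<^esub> v"
      using *(2) *(3)[symmetric] v h by (intro N.M.minus_equality[symmetric]) (simp_all add: N.M.a_comm)
    also have "\<dots> = \<ominus>\<^bsub>R\<^esub> \<one>\<^bsub>R\<^esub> \<odot>\<^bsub>N\<^esub> v" using v by (simp add: N.smult_l_minus)
    finally have "(r \<odot>\<^bsub>N\<^esub> h, \<ominus>\<^bsub>R\<^esub> \<one>\<^bsub>R\<^esub> \<odot>\<^bsub>E\<^esub> d) \<in> G" using Gs[OF _ *(1)] by simp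
    then have "r \<in> J" using *(2) by (auto simp: J_def)
    then have "(r \<odot>\<^bsub>N\<^esub> h, r \<odot>\<^bsub>E\<^esub> e1) \<in> G" using fG[of r] e1(2) by simp
    then have "(v \<oplus>\<^bsub>N\<^esub> r \<odot>\<^bsub>N\<^esub> h, d \<oplus>\<^bsub>E\<^esub> r \<odot>\<^bsub>E\<^esub> e1) \<in> G" by (rule Ga[OF *(1)])
    then show "e = \<zero>\<^bsub>E\<^esub>" using Gz *(3,4) by simp
  qed
  ultimately show ?thesis using sub by blast
qed

text \<open>Every condition concerns at most two pairs, and two pairs of the union lie in one member
  of the chain. An empty chain would miss the pair of zeros.\<close>

lemma partial_hom_Union_chain:
  assumes ne: "\<C> \<noteq> {}" and chain: "subset.chain {G. partial_hom R N E G} \<C>"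
  shows "partial_hom R N E (\<Union>\<C>)"
proof -
  have mem: "partial_hom R N E G" if "G \<in> \<C>" for G
    using chain that unfolding subset_chain_def by blast
  show ?thesis unfolding partial_hom_def
  proof (intro conjI allI impI)
    show "\<Union>\<C> \<subseteq> carrier N \<times> carrier E"
      using mem by (intro Union_least) (simp add: partial_hom_def)
    obtain G where "G \<in> \<C>" using ne by blast
    then show "(\<zero>\<^bsub>N\<^esub>, \<zero>\<^bsub>E\<^esub>) \<in> \<Union>\<C>" using mem[of G] by (auto simp: partial_hom_def)
  next
    fix e assume "(\<zero>\<^bsub>N\<^esub>, e) \<in> \<Union>\<C>"
    then obtain G where "G \<in> \<C>" "(\<zero>\<^bsub>N\<^esub>, e) \<in> G" by blast
    then show "e = \<zero>\<^bsub>E\<^esub>" using mem[of G] by (simp add: partial_hom_def)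
  next
    fix a u e assume a: "a \<in> carrier R" and "(u, e) \<in> \<Union>\<C>"
    then obtain G where G: "G \<in> \<C>" "(u, e) \<in> G" by blast
    then have "(a \<odot>\<^bsub>N\<^esub> u, a \<odot>\<^bsub>E\<^esub> e) \<in> G" using mem[of G] a by (simp add: partial_hom_def)
    then show "(a \<odot>\<^bsub>N\<^esub> u, a \<odot>\<^bsub>E\<^esub> e) \<in> \<Union>\<C>" using G(1) by blast
  next
    fix u e u' e' assume "(u, e) \<in> \<Union>\<C>" "(u', e') \<in> \<Union>\<C>"
    then obtain G1 G2 where "G1 \<in> \<C>" "(u, e) \<in> G1" "G2 \<in> \<C>" "(u', e') \<in> G2" by blast
    moreover have "G1 \<subseteq> G2 \<or> G2 \<subseteq> G1" using chain calculation(1,3) by (simp add: subset_chain_def)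
    ultimately obtain G where G: "G \<in> \<C>" "(u, e) \<in> G" "(u', e') \<in> G" by blast
    then have "(u \<oplus>\<^bsub>N\<^esub> u', e \<oplus>\<^bsub>E\<^esub> e') \<in> G" using mem[of G] by (simp add: partial_hom_def)
    then show "(u \<oplus>\<^bsub>N\<^esub> u', e \<oplus>\<^bsub>E\<^esub> e') \<in> \<Union>\<C>" using G(1) by blast
  qed
qed

text \<open>Baer's criterion for a module N carried by any type: a graph that is maximal by Zorn has
  full domain, since \<open>partial_hom_extend\<close> could otherwise enlarge it.\<close>

lemma injective_module_partial_hom_extension:
  assumes E: "injective_module R E" and N: "module R N" and G0: "partial_hom R N E G0"
  shows "\<exists>h\<in>mod_hom R N E. \<forall>(u, e)\<in>G0. h u = e"
proof -
  have Em: "module R E" using E by (simp add: injective_module_def)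
  have "\<exists>G\<in>{G. partial_hom R N E G \<and> G0 \<subseteq> G}. \<forall>G'\<in>{G. partial_hom R N E G \<and> G0 \<subseteq> G}. G \<subseteq> G' \<longrightarrow> G' = G"
  proof (rule subset_Zorn_nonempty)
    show "{G. partial_hom R N E G \<and> G0 \<subseteq> G} \<noteq> {}" using G0 by blast
    fix \<C> assume ne: "\<C> \<noteq> {}" and "subset.chain {G. partial_hom R N E G \<and> G0 \<subseteq> G} \<C>"
    then have c: "\<forall>G\<in>\<C>. partial_hom R N E G" "\<forall>G\<in>\<C>. G0 \<subseteq> G"
      "\<forall>G\<in>\<C>. \<forall>G'\<in>\<C>. G \<subseteq> G' \<or> G' \<subseteq> G"
      by (auto simp: subset_chain_def)
    then have "subset.chain {G. partial_hom R N E G} \<C>" by (auto simp: subset_chain_def)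
    with c(2) show "\<Union>\<C> \<in> {G. partial_hom R N E G \<and> G0 \<subseteq> G}"
      using partial_hom_Union_chain[OF ne] ne by blast
  qed
  then obtain G where G_mem: "G \<in> {G. partial_hom R N E G \<and> G0 \<subseteq> G}"
    and G_max: "\<forall>G'\<in>{G. partial_hom R N E G \<and> G0 \<subseteq> G}. G \<subseteq> G' \<longrightarrow> G' = G"
    by (rule bexE)
  from G_mem have G: "partial_hom R N E G" "G0 \<subseteq> G" by simp_all
  have maxG: "G' = G" if "partial_hom R N E G'" "G \<subseteq> G'" for G'
    using G_max G(2) that by simp
  have total: "\<exists>e. (u, e) \<in> G" if u: "u \<in> carrier N" for u
  proof -
    obtain G' where "partial_hom R N E G'" "G \<subseteq> G'" "u \<in> Domain G'"
      using partial_hom_extend[OF E N G(1) u] by blast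
    then show ?thesis using maxG[of G'] by auto
  qed
  have sv: "e = e'" if "(u, e) \<in> G" "(u, e') \<in> G" for u e e'
    using partial_hom_single_valued[OF G(1) N Em that] .
  define h where "h u = (THE e. (u, e) \<in> G)" for u
  have h_eq: "h u = e" if "(u, e) \<in> G" for u e
    unfolding h_def using that sv by blast
  have hG: "(u, h u) \<in> G" if "u \<in> carrier N" for u using total[OF that] h_eq by blast
  have "h \<in> mod_hom R N E"
    unfolding mod_hom_def
  proof (intro CollectI conjI ballI)
    show "h \<in> carrier N \<rightarrow> carrier E" using hG G(1) by (auto simp: partial_hom_def)
    show "h (u \<oplus>\<^bsub>N\<^esub> v) = h u \<oplus>\<^bsub>E\<^esub> h v" if "u \<in> carrier N" "v \<in> carrier N" for u v
      using hG[OF that(1)] hG[OF that(2)] that G(1) by (intro h_eq) (simp add: partial_hom_def)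
    show "h (a \<odot>\<^bsub>N\<^esub> u) = a \<odot>\<^bsub>E\<^esub> h u" if "a \<in> carrier R" "u \<in> carrier N" for a u
      using hG[OF that(2)] that G(1) by (intro h_eq) (simp add: partial_hom_def)
  qed
  then show ?thesis using h_eq G(2) by (intro bexI[of _ h]) auto
qed

section \<open>Quotient modules\<close>

context module
begin

context
  fixes B assumes B: "submodule B R M"
begin

lemma submodule_zero: "\<zero>\<^bsub>M\<^esub> \<in> B"
proof -
  interpret submodule B R M by (rule B)
  show ?thesis using one_closed by simp
qed

lemma quotient_module_carrier: "carrier (quotient_module M B) = {B +>\<^bsub>M\<^esub> u | u. u \<in> carrier M}"
  by (auto simp: quotient_module_def A_RCOSETS_def')

lemma coset_mem_iff:
  assumes "u \<in> carrier M"
  shows "v \<in> B +>\<^bsub>M\<^esub> u \<longleftrightarrow> v \<in> carrier M \<and> v \<ominus>\<^bsub>M\<^esub> u \<in> B"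
proof
  have Bc: "B \<subseteq> carrier M" by (rule submoduleE(1)[OF B])
  assume "v \<in> B +>\<^bsub>M\<^esub> u"
  then obtain b where b: "b \<in> B" "v = b \<oplus>\<^bsub>M\<^esub> u" by (auto simp: a_r_coset_def')
  then have "v \<ominus>\<^bsub>M\<^esub> u = b" using assms Bc by (auto simp: a_minus_def M.a_assoc M.r_neg)
  then show "v \<in> carrier M \<and> v \<ominus>\<^bsub>M\<^esub> u \<in> B" using b assms Bc by auto
next
  assume "v \<in> carrier M \<and> v \<ominus>\<^bsub>M\<^esub> u \<in> B"
  moreover from this have "v = (v \<ominus>\<^bsub>M\<^esub> u) \<oplus>\<^bsub>M\<^esub> u"
    using assms by (simp add: a_minus_def M.a_assoc M.l_neg)
  ultimately show "v \<in> B +>\<^bsub>M\<^esub> u" unfolding a_r_coset_def' by blast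
qed

lemma coset_self: "u \<in> carrier M \<Longrightarrow> u \<in> B +>\<^bsub>M\<^esub> u"
  using submodule_zero by (simp add: coset_mem_iff a_minus_def M.r_neg)

lemma coset_eq_iff:
  assumes "u \<in> carrier M" "v \<in> carrier M"
  shows "B +>\<^bsub>M\<^esub> u = B +>\<^bsub>M\<^esub> v \<longleftrightarrow> u \<ominus>\<^bsub>M\<^esub> v \<in> B"
proof
  assume "B +>\<^bsub>M\<^esub> u = B +>\<^bsub>M\<^esub> v"
  then have "u \<in> B +>\<^bsub>M\<^esub> v" using coset_self[OF assms(1)] by simp
  then show "u \<ominus>\<^bsub>M\<^esub> v \<in> B" using assms by (simp add: coset_mem_iff)
next
  assume uv: "u \<ominus>\<^bsub>M\<^esub> v \<in> B"
  have telescope: "x \<ominus>\<^bsub>M\<^esub> z = (x \<ominus>\<^bsub>M\<^esub> y) \<oplus>\<^bsub>M\<^esub> (y \<ominus>\<^bsub>M\<^esub> z)"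
    if "x \<in> carrier M" "y \<in> carrier M" "z \<in> carrier M" for x y z
    using that by (simp add: a_minus_def M.a_assoc M.r_neg1)
  have "v \<ominus>\<^bsub>M\<^esub> u = \<ominus>\<^bsub>M\<^esub> (u \<ominus>\<^bsub>M\<^esub> v)"
    using assms by (simp add: a_minus_def M.minus_add M.a_comm)
  then have vu: "v \<ominus>\<^bsub>M\<^esub> u \<in> B" using submoduleE(3)[OF B uv] by simp
  have "w \<ominus>\<^bsub>M\<^esub> u \<in> B \<longleftrightarrow> w \<ominus>\<^bsub>M\<^esub> v \<in> B" if w: "w \<in> carrier M" for w
    using telescope[OF w assms] telescope[OF w assms(2,1)] submoduleE(5)[OF B _ uv]
      submoduleE(5)[OF B _ vu] by metis
  then show "B +>\<^bsub>M\<^esub> u = B +>\<^bsub>M\<^esub> v" using assms by (auto simp: coset_mem_iff)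
qed

lemma coset_eq_submodule_iff:
  assumes "u \<in> carrier M" shows "B +>\<^bsub>M\<^esub> u = B \<longleftrightarrow> u \<in> B"
proof -
  have "B +>\<^bsub>M\<^esub> \<zero>\<^bsub>M\<^esub> = B"
    using submoduleE(1)[OF B] by (auto simp: coset_mem_iff a_minus_def)
  have "\<ominus>\<^bsub>M\<^esub> \<zero>\<^bsub>M\<^esub> = \<zero>\<^bsub>M\<^esub>" by (rule M.minus_equality) simp_all
  then have "u \<ominus>\<^bsub>M\<^esub> \<zero>\<^bsub>M\<^esub> = u" using assms by (metis a_minus_def M.r_zero)
  with \<open>B +>\<^bsub>M\<^esub> \<zero>\<^bsub>M\<^esub> = B\<close> show ?thesis using coset_eq_iff[OF assms M.zero_closed] by simp
qed

lemma quotient_module_zero: "\<zero>\<^bsub>quotient_module M B\<^esub> = B"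
  by (simp add: quotient_module_def)

lemma quotient_module_add:
  assumes "u \<in> carrier M" "v \<in> carrier M"
  shows "(B +>\<^bsub>M\<^esub> u) \<oplus>\<^bsub>quotient_module M B\<^esub> (B +>\<^bsub>M\<^esub> v) = B +>\<^bsub>M\<^esub> (u \<oplus>\<^bsub>M\<^esub> v)"
proof -
  interpret submodule B R M by (rule B)
  have "abelian_subgroup B M"
    by (intro abelian_subgroupI3 additive_subgroup.intro subgroup_axioms M.abelian_group_axioms)
  then show ?thesis using assms by (simp add: quotient_module_def abelian_subgroup.a_rcos_sum)
qed

text \<open>The definition takes a union over all representatives. They all give the same coset
  because \<open>B\<close> is closed under scalars, and the union is over a nonempty set.\<close>

lemma quotient_module_smult:
  assumes a: "a \<in> carrier R" and u: "u \<in> carrier M"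
  shows "a \<odot>\<^bsub>quotient_module M B\<^esub> (B +>\<^bsub>M\<^esub> u) = B +>\<^bsub>M\<^esub> (a \<odot>\<^bsub>M\<^esub> u)"
proof -
  have "B +>\<^bsub>M\<^esub> (a \<odot>\<^bsub>M\<^esub> v) = B +>\<^bsub>M\<^esub> (a \<odot>\<^bsub>M\<^esub> u)" if v: "v \<in> B +>\<^bsub>M\<^esub> u" for v
  proof -
    have vc: "v \<in> carrier M" and "v \<ominus>\<^bsub>M\<^esub> u \<in> B" using v u by (simp_all add: coset_mem_iff)
    then have "a \<odot>\<^bsub>M\<^esub> (v \<ominus>\<^bsub>M\<^esub> u) \<in> B" using a submoduleE(4)[OF B] by simp
    then have "a \<odot>\<^bsub>M\<^esub> v \<ominus>\<^bsub>M\<^esub> a \<odot>\<^bsub>M\<^esub> u \<in> B"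
      using a u vc by (simp add: a_minus_def smult_r_distr smult_r_minus)
    then show ?thesis using a u vc by (simp add: coset_eq_iff)
  qed
  then have "(\<Union>v\<in>B +>\<^bsub>M\<^esub> u. B +>\<^bsub>M\<^esub> (a \<odot>\<^bsub>M\<^esub> v)) = (\<Union>v\<in>B +>\<^bsub>M\<^esub> u. B +>\<^bsub>M\<^esub> (a \<odot>\<^bsub>M\<^esub> u))"
    by (rule SUP_cong[OF refl])
  also have "\<dots> = B +>\<^bsub>M\<^esub> (a \<odot>\<^bsub>M\<^esub> u)" using coset_self[OF u] by auto
  finally show ?thesis by (simp add: quotient_module_def)
qed

text \<open>The value is read off at an arbitrary representative; two representatives differ by an
  element of \<open>B\<close>, which \<open>f\<close> kills.\<close>

lemma mod_hom_quotient_module: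
  assumes f: "f \<in> mod_hom R M E" and E: "module R E" and B0: "\<And>b. b \<in> B \<Longrightarrow> f b = \<zero>\<^bsub>E\<^esub>"
  shows "\<exists>h\<in>mod_hom R (quotient_module M B) E. \<forall>u\<in>carrier M. h (B +>\<^bsub>M\<^esub> u) = f u"
proof -
  interpret E: module R E by (rule E)
  define h where "h U = f (SOME u. u \<in> U)" for U
  have h: "h (B +>\<^bsub>M\<^esub> u) = f u" if u: "u \<in> carrier M" for u
  proof -
    define v where "v = (SOME v. v \<in> B +>\<^bsub>M\<^esub> u)"
    have "v \<in> B +>\<^bsub>M\<^esub> u" unfolding v_def by (rule someI) (rule coset_self[OF u])
    then have vc: "v \<in> carrier M" and vu: "v \<ominus>\<^bsub>M\<^esub> u \<in> B" using u by (simp_all add: coset_mem_iff)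
    have "f v \<ominus>\<^bsub>E\<^esub> f u = \<zero>\<^bsub>E\<^esub>"
      using B0[OF vu] mod_hom_minus[OF f module_axioms E vc u] by simp
    then have "f v = f u" by (rule E.minus_zero_imp_eq) (use mod_homD(1)[OF f] vc u in auto)
    then show ?thesis by (simp add: h_def v_def)
  qed
  have "h \<in> mod_hom R (quotient_module M B) E"
    unfolding mod_hom_def quotient_module_carrier
    by (auto simp: h quotient_module_add quotient_module_smult mod_homD[OF f])
  then show ?thesis using h by blast
qed

end

end

text \<open>The assignment b + r w |-> r e on B + R w is well defined by \<open>ann\<close>: if b +
  r w = 0, then r w lies in \<open>B\<close>. Its extension to \<open>N\<close> vanishes on
  \<open>B\<close> and so descends to the quotient.\<close>

lemma nonzero_hom_to_injective_module:
  assumes E: "injective_module R E" and N: "module R N" and B: "submodule B R N"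
    and w: "w \<in> carrier N" and e: "e \<in> carrier E"
    and ann: "\<And>r. r \<in> carrier R \<Longrightarrow> r \<odot>\<^bsub>N\<^esub> w \<in> B \<Longrightarrow> r \<odot>\<^bsub>E\<^esub> e = \<zero>\<^bsub>E\<^esub>"
  shows "\<exists>f\<in>mod_hom R (quotient_module N B) E. f (B +>\<^bsub>N\<^esub> w) = e"
proof -
  have Em: "module R E" using E by (simp add: injective_module_def)
  interpret N: module R N by fact
  interpret E: module R E by fact
  note Bc = subsetD[OF N.submoduleE(1)[OF B]]
  define G where "G = {(b \<oplus>\<^bsub>N\<^esub> r \<odot>\<^bsub>N\<^esub> w, r \<odot>\<^bsub>E\<^esub> e) | b r. b \<in> B \<and> r \<in> carrier R}"
  have GI: "(u, d) \<in> G" if "b \<in> B" "r \<in> carrier R" "u = b \<oplus>\<^bsub>N\<^esub> r \<odot>\<^bsub>N\<^esub> w" "d = r \<odot>\<^bsub>E\<^esub> e" for b r u d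
    using that unfolding G_def by blast
  have B0: "\<zero>\<^bsub>N\<^esub> \<in> B" by (rule N.submodule_zero[OF B])
  have "partial_hom R N E G"
    unfolding partial_hom_def
  proof (intro conjI allI impI)
    show "G \<subseteq> carrier N \<times> carrier E" using Bc w e unfolding G_def by auto
    show "(\<zero>\<^bsub>N\<^esub>, \<zero>\<^bsub>E\<^esub>) \<in> G" using w e by (intro GI[OF B0 N.R.zero_closed]) auto
  next
    fix u d u' d' assume "(u, d) \<in> G" "(u', d') \<in> G"
    then obtain b r b' r' where *: "b \<in> B" "r \<in> carrier R" "b' \<in> B" "r' \<in> carrier R"
      "u = b \<oplus>\<^bsub>N\<^esub> r \<odot>\<^bsub>N\<^esub> w" "d = r \<odot>\<^bsub>E\<^esub> e" "u' = b' \<oplus>\<^bsub>N\<^esub> r' \<odot>\<^bsub>N\<^esub> w" "d' = r' \<odot>\<^bsub>E\<^esub> e"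
      unfolding G_def by blast
    show "(u \<oplus>\<^bsub>N\<^esub> u', d \<oplus>\<^bsub>E\<^esub> d') \<in> G"
    proof (rule GI)
      show "b \<oplus>\<^bsub>N\<^esub> b' \<in> B" using *(1,3) by (rule N.submoduleE(5)[OF B])
      show "r \<oplus>\<^bsub>R\<^esub> r' \<in> carrier R" using *(2,4) by simp
      show "u \<oplus>\<^bsub>N\<^esub> u' = b \<oplus>\<^bsub>N\<^esub> b' \<oplus>\<^bsub>N\<^esub> (r \<oplus>\<^bsub>R\<^esub> r') \<odot>\<^bsub>N\<^esub> w"
        unfolding *(5,7) using Bc[OF *(1)] Bc[OF *(3)] *(2,4) w by (simp add: N.smult_l_distr N.M.a_ac)
      show "d \<oplus>\<^bsub>E\<^esub> d' = (r \<oplus>\<^bsub>R\<^esub> r') \<odot>\<^bsub>E\<^esub> e"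
        unfolding *(6,8) using *(2,4) e by (simp add: E.smult_l_distr)
    qed
  next
    fix a u d assume a: "a \<in> carrier R" and "(u, d) \<in> G"
    then obtain b r where *: "b \<in> B" "r \<in> carrier R" "u = b \<oplus>\<^bsub>N\<^esub> r \<odot>\<^bsub>N\<^esub> w" "d = r \<odot>\<^bsub>E\<^esub> e"
      unfolding G_def by blast
    show "(a \<odot>\<^bsub>N\<^esub> u, a \<odot>\<^bsub>E\<^esub> d) \<in> G"
    proof (rule GI)
      show "a \<odot>\<^bsub>N\<^esub> b \<in> B" using a *(1) by (rule N.submoduleE(4)[OF B])
      show "a \<otimes>\<^bsub>R\<^esub> r \<in> carrier R" using a *(2) by simp
      show "a \<odot>\<^bsub>N\<^esub> u = a \<odot>\<^bsub>N\<^esub> b \<oplus>\<^bsub>N\<^esub> (a \<otimes>\<^bsub>R\<^esub> r) \<odot>\<^bsub>N\<^esub> w"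
        unfolding *(3) using Bc[OF *(1)] *(2) a w by (simp add: N.smult_r_distr N.smult_assoc1)
      show "a \<odot>\<^bsub>E\<^esub> d = (a \<otimes>\<^bsub>R\<^esub> r) \<odot>\<^bsub>E\<^esub> e"
        unfolding *(4) using *(2) a e by (simp add: E.smult_assoc1)
    qed
  next
    fix d assume "(\<zero>\<^bsub>N\<^esub>, d) \<in> G"
    then obtain b r where *: "b \<in> B" "r \<in> carrier R" "\<zero>\<^bsub>N\<^esub> = b \<oplus>\<^bsub>N\<^esub> r \<odot>\<^bsub>N\<^esub> w" "d = r \<odot>\<^bsub>E\<^esub> e"
      unfolding G_def by blast
    have "\<ominus>\<^bsub>N\<^esub> b = r \<odot>\<^bsub>N\<^esub> w"
      using *(2) *(3)[symmetric] Bc[OF *(1)] w by (intro N.M.minus_equality) (simp_all add: N.M.a_comm)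
    then have "r \<odot>\<^bsub>N\<^esub> w \<in> B" using N.submoduleE(3)[OF B *(1)] by simp
    then show "d = \<zero>\<^bsub>E\<^esub>" using ann *(2,4) by simp
  qed
  then obtain F where F: "F \<in> mod_hom R N E" "\<forall>(u, d)\<in>G. F u = d"
    using injective_module_partial_hom_extension[OF E N] by blast
  have F_eq: "F u = d" if "(u, d) \<in> G" for u d using F(2) that by auto
  have "F b = \<zero>\<^bsub>E\<^esub>" if "b \<in> B" for b
    by (rule F_eq, rule GI[OF that N.R.zero_closed]) (use Bc[OF that] w e in auto)
  moreover have "F w = e"
    by (rule F_eq, rule GI[OF B0 N.R.one_closed]) (use w e in auto)
  ultimately show ?thesis
    using N.mod_hom_quotient_module[OF B F(1) Em] w by blast
qed

context module
begin

lemma quotient_module_module: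
  assumes B: "submodule B R M"
  shows "module R (quotient_module M B)"
proof -
  let ?Q = "quotient_module M B"
  note carrier = quotient_module_carrier[OF B]
  note add = quotient_module_add[OF B]
  note smult = quotient_module_smult[OF B]
  have zero: "\<zero>\<^bsub>?Q\<^esub> = B +>\<^bsub>M\<^esub> \<zero>\<^bsub>M\<^esub>"
    using coset_eq_submodule_iff[OF B M.zero_closed] submodule_zero[OF B] by (simp add: quotient_module_zero[OF B])
  show ?thesis
  proof (rule moduleI)
    show "abelian_group ?Q"
    proof (rule abelian_groupI)
      fix U assume "U \<in> carrier ?Q"
      then obtain u where u: "u \<in> carrier M" "U = B +>\<^bsub>M\<^esub> u" by (auto simp: carrier)
      have "B +>\<^bsub>M\<^esub> (\<ominus>\<^bsub>M\<^esub> u) \<in> carrier ?Q" using u(1) unfolding carrier by blast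
      then show "\<exists>V\<in>carrier ?Q. V \<oplus>\<^bsub>?Q\<^esub> U = \<zero>\<^bsub>?Q\<^esub>"
        by (rule bexI[rotated]) (use u in \<open>simp add: add zero M.l_neg\<close>)
      show "\<zero>\<^bsub>?Q\<^esub> \<oplus>\<^bsub>?Q\<^esub> U = U" using u by (simp add: add zero)
    qed (auto simp: carrier add zero M.a_ac)
  qed (auto simp: carrier add smult smult_l_distr smult_r_distr smult_assoc1 intro: is_cring)
qed

end

section \<open>Tensor products\<close>

text \<open>The two sides form inverses in different groups, and these are known to be negation only
  on the respective carriers; hence the condition that \<open>H\<close> lies in the smaller
  carrier.\<close>

lemma generate_free_Abelian_group_mono:
  assumes "S \<subseteq> S'" "H \<subseteq> carrier (free_Abelian_group S)" "H \<subseteq> H'"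
  shows "generate (free_Abelian_group S) H \<subseteq> generate (free_Abelian_group S') H'"
proof
  fix c assume "c \<in> generate (free_Abelian_group S) H"
  then show "c \<in> generate (free_Abelian_group S') H'"
  proof (induction rule: generate.induct)
    case one
    then show ?case using generate.one[of "free_Abelian_group S'"] by simp
  next
    case (incl h)
    then show ?case using assms by (auto intro: generate.incl)
  next
    case (inv h)
    then have "h \<in> carrier (free_Abelian_group S)" "h \<in> H'" using subsetD[OF assms(2)] subsetD[OF assms(3)] by blast+
    moreover from this have "Poly_Mapping.keys h \<subseteq> S" "Poly_Mapping.keys h \<subseteq> S'" using assms(1) by auto
    ultimately show ?case using generate.inv[of h H' "free_Abelian_group S'"] by simp
  next
    case (eng h1 h2)
    then show ?case using generate.eng[of h1 "free_Abelian_group S'" H' h2] by simp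
  qed
qed

context
  fixes R :: "('a, 'r) ring_scheme" and B :: "('a, 'b, 'm) module_scheme"
    and N :: "('a, 'c, 'n) module_scheme"
  assumes B: "module R B" and N: "module R N"
begin

interpretation B: module R B by (rule B)
interpretation N: module R N by (rule N)

lemma tensor_relations_add:
  assumes "c \<in> tensor_relations R B N" "d \<in> tensor_relations R B N"
  shows "c + d \<in> tensor_relations R B N"
  using assms generate.eng[of c "tensor_gens B N" _ d]
  unfolding tensor_relations_def by (simp add: tensor_gens_def)

lemma tensor_gens_diff:
  assumes "c \<in> carrier (tensor_gens B N)" "d \<in> carrier (tensor_gens B N)"
  shows "c - d \<in> carrier (tensor_gens B N)"
  using assms keys_diff[of c d] by (auto simp: tensor_gens_def)

lemma frag_of_in_tensor_gens:
  "b \<in> carrier B \<Longrightarrow> u \<in> carrier N \<Longrightarrow> frag_of (b, u) \<in> carrier (tensor_gens B N)"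
  by (simp add: tensor_gens_def)

lemma tensor_relations_frag_add_left:
  assumes b: "b \<in> carrier B" "b' \<in> carrier B" "u \<in> carrier N"
    and T: "frag_of (b, u) \<in> tensor_relations R B N" "frag_of (b', u) \<in> tensor_relations R B N"
  shows "frag_of (b \<oplus>\<^bsub>B\<^esub> b', u) \<in> tensor_relations R B N"
proof -
  have "frag_of (b \<oplus>\<^bsub>B\<^esub> b', u) - frag_of (b, u) - frag_of (b', u) \<in> tensor_relations R B N"
    unfolding tensor_relations_def by (rule generate.incl) (use b in blast)
  then have "frag_of (b \<oplus>\<^bsub>B\<^esub> b', u) - frag_of (b, u) - frag_of (b', u) + frag_of (b, u) + frag_of (b', u)
      \<in> tensor_relations R B N"
    using T by (intro tensor_relations_add)
  then show ?thesis by simp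
qed

lemma tensor_relations_frag_smult_iff:
  assumes a: "a \<in> carrier R" "b \<in> carrier B" "u \<in> carrier N"
  shows "frag_of (a \<odot>\<^bsub>B\<^esub> b, u) \<in> tensor_relations R B N \<longleftrightarrow> frag_of (b, a \<odot>\<^bsub>N\<^esub> u) \<in> tensor_relations R B N"
proof -
  let ?g = "frag_of (a \<odot>\<^bsub>B\<^esub> b, u) - frag_of (b, a \<odot>\<^bsub>N\<^esub> u)"
  have "?g \<in> tensor_relations R B N"
    unfolding tensor_relations_def by (rule generate.incl) (use a in blast)
  moreover have "inv\<^bsub>tensor_gens B N\<^esub> ?g \<in> tensor_relations R B N"
    unfolding tensor_relations_def by (rule generate.inv) (use a in blast)
  moreover have "?g \<in> carrier (tensor_gens B N)"
    using a by (intro tensor_gens_diff frag_of_in_tensor_gens) auto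
  then have "inv\<^bsub>tensor_gens B N\<^esub> ?g = - ?g" unfolding tensor_gens_def by simp
  ultimately show ?thesis
    using tensor_relations_add[of ?g "frag_of (b, a \<odot>\<^bsub>N\<^esub> u)"]
      tensor_relations_add[of "- ?g" "frag_of (a \<odot>\<^bsub>B\<^esub> b, u)"] by auto
qed

lemma tensor_relations_frag_zero_right:
  assumes b: "b \<in> carrier B" shows "frag_of (b, \<zero>\<^bsub>N\<^esub>) \<in> tensor_relations R B N"
proof -
  let ?g = "frag_of (b, \<zero>\<^bsub>N\<^esub> \<oplus>\<^bsub>N\<^esub> \<zero>\<^bsub>N\<^esub>) - frag_of (b, \<zero>\<^bsub>N\<^esub>) - frag_of (b, \<zero>\<^bsub>N\<^esub>)"
  have "inv\<^bsub>tensor_gens B N\<^esub> ?g \<in> tensor_relations R B N"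
    unfolding tensor_relations_def by (rule generate.inv) (use b N.M.zero_closed in blast)
  moreover have "?g \<in> carrier (tensor_gens B N)"
    using b by (intro tensor_gens_diff frag_of_in_tensor_gens) auto
  then have "inv\<^bsub>tensor_gens B N\<^esub> ?g = - ?g" unfolding tensor_gens_def by simp
  ultimately show ?thesis by simp
qed

text \<open>A symbol \<open>frag_of (b, u)\<close> among the relations stands for a vanishing pure
  tensor. Moving scalars across, b \<otimes> z u = z b \<otimes> u = b1 \<otimes> x u + b2 \<otimes>
  y u, where both terms on the right vanish.\<close>

lemma tensor_relations_frag_annihilated:
  assumes R: "x \<in> carrier R" "y \<in> carrier R" "z \<in> carrier R" and u: "u \<in> carrier N"
    and ann: "x \<odot>\<^bsub>N\<^esub> u = \<zero>\<^bsub>N\<^esub>" "y \<odot>\<^bsub>N\<^esub> u = \<zero>\<^bsub>N\<^esub>"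
    and b: "b \<in> carrier B" "b1 \<in> carrier B" "b2 \<in> carrier B"
    and zb: "z \<odot>\<^bsub>B\<^esub> b = x \<odot>\<^bsub>B\<^esub> b1 \<oplus>\<^bsub>B\<^esub> y \<odot>\<^bsub>B\<^esub> b2"
  shows "frag_of (b, z \<odot>\<^bsub>N\<^esub> u) \<in> tensor_relations R B N"
proof -
  have "frag_of (x \<odot>\<^bsub>B\<^esub> b1, u) \<in> tensor_relations R B N" "frag_of (y \<odot>\<^bsub>B\<^esub> b2, u) \<in> tensor_relations R B N"
    using R u b ann by (simp_all add: tensor_relations_frag_smult_iff tensor_relations_frag_zero_right)
  then have "frag_of (z \<odot>\<^bsub>B\<^esub> b, u) \<in> tensor_relations R B N"
    unfolding zb using R u b by (intro tensor_relations_frag_add_left) auto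
  then show ?thesis using R u b by (simp add: tensor_relations_frag_smult_iff)
qed

text \<open>Needed to see that \<open>tensor_incl\<close> sends the zero element of the tensor
  product with the zero submodule to zero.\<close>

lemma tensor_relations_zero_submodule_subset:
  "tensor_relations R B (N\<lparr>carrier := {\<zero>\<^bsub>N\<^esub>}\<rparr>) \<subseteq> tensor_relations R B N"
  unfolding tensor_relations_def tensor_gens_def
proof (rule generate_free_Abelian_group_mono)
  let ?S = "carrier B \<times> {\<zero>\<^bsub>N\<^esub>}"
  have frag: "frag_of (b, \<zero>\<^bsub>N\<^esub>) \<in> carrier (free_Abelian_group ?S)" if "b \<in> carrier B" for b
    using that by simp
  have diff: "c - d \<in> carrier (free_Abelian_group ?S)"
    if "c \<in> carrier (free_Abelian_group ?S)" "d \<in> carrier (free_Abelian_group ?S)" for c d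
    using that keys_diff[of c d] by auto
  have neg: "- frag_of (b, \<zero>\<^bsub>N\<^esub>) \<in> carrier (free_Abelian_group ?S)" if "b \<in> carrier B" for b
    using that by simp
  show "{frag_of (b \<oplus>\<^bsub>B\<^esub> b', u) - frag_of (b, u) - frag_of (b', u) | b b' u.
        b \<in> carrier B \<and> b' \<in> carrier B \<and> u \<in> carrier (N\<lparr>carrier := {\<zero>\<^bsub>N\<^esub>}\<rparr>)} \<union>
     {frag_of (b, u \<oplus>\<^bsub>N\<lparr>carrier := {\<zero>\<^bsub>N\<^esub>}\<rparr>\<^esub> u') - frag_of (b, u) - frag_of (b, u') | b u u'.
        b \<in> carrier B \<and> u \<in> carrier (N\<lparr>carrier := {\<zero>\<^bsub>N\<^esub>}\<rparr>) \<and> u' \<in> carrier (N\<lparr>carrier := {\<zero>\<^bsub>N\<^esub>}\<rparr>)} \<union>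
     {frag_of (a \<odot>\<^bsub>B\<^esub> b, u) - frag_of (b, a \<odot>\<^bsub>N\<lparr>carrier := {\<zero>\<^bsub>N\<^esub>}\<rparr>\<^esub> u) | a b u.
        a \<in> carrier R \<and> b \<in> carrier B \<and> u \<in> carrier (N\<lparr>carrier := {\<zero>\<^bsub>N\<^esub>}\<rparr>)}
     \<subseteq> carrier (free_Abelian_group (carrier B \<times> carrier (N\<lparr>carrier := {\<zero>\<^bsub>N\<^esub>}\<rparr>)))"
    by (intro Un_least subsetI; elim CollectE exE conjE) (auto simp del: carrier_free_Abelian_group_iff intro!: diff frag neg)
  have N0: "carrier (N\<lparr>carrier := {\<zero>\<^bsub>N\<^esub>}\<rparr>) \<subseteq> carrier N" by simp
  then show "carrier B \<times> carrier (N\<lparr>carrier := {\<zero>\<^bsub>N\<^esub>}\<rparr>) \<subseteq> carrier B \<times> carrier N" by blast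
  have ops: "ring.add (N\<lparr>carrier := {\<zero>\<^bsub>N\<^esub>}\<rparr>) = ring.add N" "module.smult (N\<lparr>carrier := {\<zero>\<^bsub>N\<^esub>}\<rparr>) = module.smult N"
    by simp_all
  show "{frag_of (b \<oplus>\<^bsub>B\<^esub> b', u) - frag_of (b, u) - frag_of (b', u) | b b' u.
        b \<in> carrier B \<and> b' \<in> carrier B \<and> u \<in> carrier (N\<lparr>carrier := {\<zero>\<^bsub>N\<^esub>}\<rparr>)} \<union>
     {frag_of (b, u \<oplus>\<^bsub>N\<lparr>carrier := {\<zero>\<^bsub>N\<^esub>}\<rparr>\<^esub> u') - frag_of (b, u) - frag_of (b, u') | b u u'.
        b \<in> carrier B \<and> u \<in> carrier (N\<lparr>carrier := {\<zero>\<^bsub>N\<^esub>}\<rparr>) \<and> u' \<in> carrier (N\<lparr>carrier := {\<zero>\<^bsub>N\<^esub>}\<rparr>)} \<union>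
     {frag_of (a \<odot>\<^bsub>B\<^esub> b, u) - frag_of (b, a \<odot>\<^bsub>N\<lparr>carrier := {\<zero>\<^bsub>N\<^esub>}\<rparr>\<^esub> u) | a b u.
        a \<in> carrier R \<and> b \<in> carrier B \<and> u \<in> carrier (N\<lparr>carrier := {\<zero>\<^bsub>N\<^esub>}\<rparr>)}
     \<subseteq> {frag_of (b \<oplus>\<^bsub>B\<^esub> b', u) - frag_of (b, u) - frag_of (b', u) | b b' u.
        b \<in> carrier B \<and> b' \<in> carrier B \<and> u \<in> carrier N} \<union>
     {frag_of (b, u \<oplus>\<^bsub>N\<^esub> u') - frag_of (b, u) - frag_of (b, u') | b u u'.
        b \<in> carrier B \<and> u \<in> carrier N \<and> u' \<in> carrier N} \<union>
     {frag_of (a \<odot>\<^bsub>B\<^esub> b, u) - frag_of (b, a \<odot>\<^bsub>N\<^esub> u) | a b u.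
        a \<in> carrier R \<and> b \<in> carrier B \<and> u \<in> carrier N}"
    unfolding ops using N0 by (intro Un_mono) blast+
qed

text \<open>The zero of a tensor product is its subgroup of relations. The hypothesis makes each
  pure tensor equal to that zero, which is the image of the zero of B \<otimes> 0.\<close>

lemma module_closure_zeroI:
  assumes u: "u \<in> carrier N" and T: "\<And>b. b \<in> carrier B \<Longrightarrow> frag_of (b, u) \<in> tensor_relations R B N"
  shows "u \<in> module_closure R B N {\<zero>\<^bsub>N\<^esub>}"
proof -
  let ?N0 = "N\<lparr>carrier := {\<zero>\<^bsub>N\<^esub>}\<rparr>"
  let ?T = "tensor_relations R B N" and ?S = "tensor_relations R B ?N0"
  have "0 \<in> ?S"
    using generate.one[of "tensor_gens B ?N0"] unfolding tensor_relations_def by (simp add: tensor_gens_def)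
  have incl: "tensor_incl R B N ?S = ?T"
  proof
    show "tensor_incl R B N ?S \<subseteq> ?T"
    proof
      fix c assume "c \<in> tensor_incl R B N ?S"
      then obtain d e where "d \<in> ?T" "e \<in> ?S" and c: "c = d + e"
        by (auto simp: tensor_incl_def set_mult_def tensor_gens_def)
      then show "c \<in> ?T"
        unfolding c using subsetD[OF tensor_relations_zero_submodule_subset] by (intro tensor_relations_add)
    qed
    show "?T \<subseteq> tensor_incl R B N ?S"
      using \<open>0 \<in> ?S\<close> by (force simp: tensor_incl_def set_mult_def tensor_gens_def)
  qed
  have mem: "?S \<in> carrier (tensor_product R B ?N0)"
  proof -
    have "?S = ?S #>\<^bsub>tensor_gens B ?N0\<^esub> 0" by (simp add: r_coset_def tensor_gens_def)
    moreover have "0 \<in> carrier (tensor_gens B ?N0)" by (simp add: tensor_gens_def)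
    ultimately show ?thesis unfolding tensor_product_def FactGroup_def RCOSETS_def by auto
  qed
  have "pure_tensor R B N b u = ?T" if b: "b \<in> carrier B" for b
  proof -
    \<comment> \<open>The negative is a sum of relations: the one for b + (- b) = 0, the one for 0 +
      0 = 0, and the hypothesis applied to - b.\<close>
    have neg: "- frag_of (b, u) \<in> ?T"
    proof -
      have diff: "frag_of (b1 \<oplus>\<^bsub>B\<^esub> b2, u) - frag_of (b1, u) - frag_of (b2, u) \<in> ?T"
        if "b1 \<in> carrier B" "b2 \<in> carrier B" for b1 b2
        unfolding tensor_relations_def by (rule generate.incl) (use that u in blast)
      have "frag_of (\<zero>\<^bsub>B\<^esub>, u) - frag_of (b, u) - frag_of (\<ominus>\<^bsub>B\<^esub> b, u) \<in> ?T"
        "- frag_of (\<zero>\<^bsub>B\<^esub>, u) \<in> ?T"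
        using diff[of b "\<ominus>\<^bsub>B\<^esub> b"] diff[of "\<zero>\<^bsub>B\<^esub>" "\<zero>\<^bsub>B\<^esub>"] b by (simp_all add: B.M.r_neg)
      then have "frag_of (\<zero>\<^bsub>B\<^esub>, u) - frag_of (b, u) - frag_of (\<ominus>\<^bsub>B\<^esub> b, u) + - frag_of (\<zero>\<^bsub>B\<^esub>, u)
          + frag_of (\<ominus>\<^bsub>B\<^esub> b, u) \<in> ?T"
        using T[of "\<ominus>\<^bsub>B\<^esub> b"] b by (intro tensor_relations_add) auto
      then show ?thesis by simp
    qed
    show ?thesis
    proof
      show "pure_tensor R B N b u \<subseteq> ?T"
        using tensor_relations_add T[OF b] by (auto simp: pure_tensor_def r_coset_def tensor_gens_def)
      show "?T \<subseteq> pure_tensor R B N b u"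
      proof
        fix c assume "c \<in> ?T"
        then have "c + - frag_of (b, u) \<in> ?T" using neg by (rule tensor_relations_add)
        then show "c \<in> pure_tensor R B N b u"
          by (force simp: pure_tensor_def r_coset_def tensor_gens_def)
      qed
    qed
  qed
  then show ?thesis unfolding module_closure_def using u incl mem by auto
qed

end

section \<open>A nonzero class in local cohomology\<close>

text \<open>On the ideal (x, y) the rule r x + s y |-> r e1 + s e2 is well defined by
  \<open>syz\<close>. It extends to R, and the value at 1 solves both equations.\<close>

lemma injective_module_solve_two:
  fixes R :: "('a, 'r) ring_scheme"
  assumes E: "injective_module R E" and R: "x \<in> carrier R" "y \<in> carrier R"
    and e: "e1 \<in> carrier E" "e2 \<in> carrier E"
    and syz: "\<And>r s. r \<in> carrier R \<Longrightarrow> s \<in> carrier R \<Longrightarrow> r \<otimes>\<^bsub>R\<^esub> x \<oplus>\<^bsub>R\<^esub> s \<otimes>\<^bsub>R\<^esub> y = \<zero>\<^bsub>R\<^esub> \<Longrightarrow>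
      r \<odot>\<^bsub>E\<^esub> e1 \<oplus>\<^bsub>E\<^esub> s \<odot>\<^bsub>E\<^esub> e2 = \<zero>\<^bsub>E\<^esub>"
  shows "\<exists>d\<in>carrier E. x \<odot>\<^bsub>E\<^esub> d = e1 \<and> y \<odot>\<^bsub>E\<^esub> d = e2"
proof -
  interpret E: module R E using E by (simp add: injective_module_def)
  let ?R = "regular_module R"
  have N: "module R ?R" by (rule E.R.regular_module_module)
  have ops: "carrier ?R = carrier R" "ring.add ?R = ring.add R" "\<zero>\<^bsub>?R\<^esub> = \<zero>\<^bsub>R\<^esub>"
    "module.smult ?R = monoid.mult R"
    by (simp_all add: regular_module_def)
  define G where "G = {(r \<otimes>\<^bsub>R\<^esub> x \<oplus>\<^bsub>R\<^esub> s \<otimes>\<^bsub>R\<^esub> y, r \<odot>\<^bsub>E\<^esub> e1 \<oplus>\<^bsub>E\<^esub> s \<odot>\<^bsub>E\<^esub> e2) | r s. r \<in> carrier R \<and> s \<in> carrier R}"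
  have GI: "(u, d) \<in> G" if "r \<in> carrier R" "s \<in> carrier R" "u = r \<otimes>\<^bsub>R\<^esub> x \<oplus>\<^bsub>R\<^esub> s \<otimes>\<^bsub>R\<^esub> y"
    "d = r \<odot>\<^bsub>E\<^esub> e1 \<oplus>\<^bsub>E\<^esub> s \<odot>\<^bsub>E\<^esub> e2" for r s u d
    using that unfolding G_def by blast
  have "partial_hom R ?R E G"
    unfolding partial_hom_def ops
  proof (intro conjI allI impI)
    show "G \<subseteq> carrier R \<times> carrier E" using R e unfolding G_def by auto
    show "(\<zero>\<^bsub>R\<^esub>, \<zero>\<^bsub>E\<^esub>) \<in> G" using R e by (intro GI[of "\<zero>\<^bsub>R\<^esub>" "\<zero>\<^bsub>R\<^esub>"]) auto
  next
    fix u d u' d' assume "(u, d) \<in> G" "(u', d') \<in> G"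
    then obtain r s r' s' where *: "r \<in> carrier R" "s \<in> carrier R" "r' \<in> carrier R" "s' \<in> carrier R"
      "u = r \<otimes>\<^bsub>R\<^esub> x \<oplus>\<^bsub>R\<^esub> s \<otimes>\<^bsub>R\<^esub> y" "d = r \<odot>\<^bsub>E\<^esub> e1 \<oplus>\<^bsub>E\<^esub> s \<odot>\<^bsub>E\<^esub> e2"
      "u' = r' \<otimes>\<^bsub>R\<^esub> x \<oplus>\<^bsub>R\<^esub> s' \<otimes>\<^bsub>R\<^esub> y" "d' = r' \<odot>\<^bsub>E\<^esub> e1 \<oplus>\<^bsub>E\<^esub> s' \<odot>\<^bsub>E\<^esub> e2"
      unfolding G_def by blast
    show "(u \<oplus>\<^bsub>R\<^esub> u', d \<oplus>\<^bsub>E\<^esub> d') \<in> G"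
    proof (rule GI)
      show "r \<oplus>\<^bsub>R\<^esub> r' \<in> carrier R" "s \<oplus>\<^bsub>R\<^esub> s' \<in> carrier R" using * by simp_all
      show "u \<oplus>\<^bsub>R\<^esub> u' = (r \<oplus>\<^bsub>R\<^esub> r') \<otimes>\<^bsub>R\<^esub> x \<oplus>\<^bsub>R\<^esub> (s \<oplus>\<^bsub>R\<^esub> s') \<otimes>\<^bsub>R\<^esub> y"
        unfolding *(5,7) using *(1-4) R by (simp add: E.R.l_distr E.R.a_ac)
      show "d \<oplus>\<^bsub>E\<^esub> d' = (r \<oplus>\<^bsub>R\<^esub> r') \<odot>\<^bsub>E\<^esub> e1 \<oplus>\<^bsub>E\<^esub> (s \<oplus>\<^bsub>R\<^esub> s') \<odot>\<^bsub>E\<^esub> e2"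
        unfolding *(6,8) using *(1-4) e by (simp add: E.smult_l_distr E.M.a_ac)
    qed
  next
    fix a u d assume a: "a \<in> carrier R" and "(u, d) \<in> G"
    then obtain r s where *: "r \<in> carrier R" "s \<in> carrier R"
      "u = r \<otimes>\<^bsub>R\<^esub> x \<oplus>\<^bsub>R\<^esub> s \<otimes>\<^bsub>R\<^esub> y" "d = r \<odot>\<^bsub>E\<^esub> e1 \<oplus>\<^bsub>E\<^esub> s \<odot>\<^bsub>E\<^esub> e2"
      unfolding G_def by blast
    show "(a \<otimes>\<^bsub>R\<^esub> u, a \<odot>\<^bsub>E\<^esub> d) \<in> G"
    proof (rule GI)
      show "a \<otimes>\<^bsub>R\<^esub> r \<in> carrier R" "a \<otimes>\<^bsub>R\<^esub> s \<in> carrier R" using a * by simp_all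
      show "a \<otimes>\<^bsub>R\<^esub> u = a \<otimes>\<^bsub>R\<^esub> r \<otimes>\<^bsub>R\<^esub> x \<oplus>\<^bsub>R\<^esub> a \<otimes>\<^bsub>R\<^esub> s \<otimes>\<^bsub>R\<^esub> y"
        unfolding *(3) using *(1,2) a R by (simp add: E.R.r_distr E.R.m_assoc)
      show "a \<odot>\<^bsub>E\<^esub> d = (a \<otimes>\<^bsub>R\<^esub> r) \<odot>\<^bsub>E\<^esub> e1 \<oplus>\<^bsub>E\<^esub> (a \<otimes>\<^bsub>R\<^esub> s) \<odot>\<^bsub>E\<^esub> e2"
        unfolding *(4) using *(1,2) a e by (simp add: E.smult_r_distr E.smult_assoc1)
    qed
  next
    show "d = \<zero>\<^bsub>E\<^esub>" if "(\<zero>\<^bsub>R\<^esub>, d) \<in> G" for d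
      using that syz unfolding G_def by force
  qed
  then obtain h where h: "h \<in> mod_hom R ?R E" "\<forall>(u, d)\<in>G. h u = d"
    using injective_module_partial_hom_extension[OF E N] by blast
  have one: "\<one>\<^bsub>R\<^esub> \<in> carrier ?R" by (simp add: ops)
  have h_one: "a \<odot>\<^bsub>E\<^esub> h \<one>\<^bsub>R\<^esub> = h a" if "a \<in> carrier R" for a
    using mod_homD(3)[OF h(1) that one] that by (simp add: ops)
  have "(x, e1) \<in> G" using R e by (intro GI[of "\<one>\<^bsub>R\<^esub>" "\<zero>\<^bsub>R\<^esub>"]) auto
  moreover have "(y, e2) \<in> G" using R e by (intro GI[of "\<zero>\<^bsub>R\<^esub>" "\<one>\<^bsub>R\<^esub>"]) auto
  ultimately have "x \<odot>\<^bsub>E\<^esub> h \<one>\<^bsub>R\<^esub> = e1" "y \<odot>\<^bsub>E\<^esub> h \<one>\<^bsub>R\<^esub> = e2"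
    using h(2) R by (auto simp: h_one)
  then show ?thesis using mod_homD(1)[OF h(1) one] by blast
qed

text \<open>With \<open>a\<close> and \<open>d\<close> chosen such that \<open>x a = \<epsilon> 1\<close>, \<open>x d = 0\<close> and \<open>y d = \<delta>0 a\<close>, the class of
  \<open>\<delta>1 d\<close> is \<open>[1 / (x y)]\<close>.\<close>

lemma injective_resolution_nonzero_class:
  fixes R (structure)
  assumes I0: "injective_module R I0" and I1: "injective_module R I1" and I2: "module R I2"
    and \<epsilon>: "\<epsilon> \<in> mod_hom R (regular_module R) I0" and inj: "inj_on \<epsilon> (carrier R)"
    and \<delta>0: "\<delta>0 \<in> mod_hom R I0 I1" and \<delta>1: "\<delta>1 \<in> mod_hom R I1 I2"
    and ex0: "\<epsilon> ` carrier R = mod_ker I0 I1 \<delta>0" and ex1: "\<delta>0 ` carrier I0 = mod_ker I1 I2 \<delta>1"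
    and R: "x \<in> carrier R" "y \<in> carrier R" "z \<in> carrier R"
    and reg_x: "\<And>r. r \<in> carrier R \<Longrightarrow> r \<otimes> x = \<zero> \<Longrightarrow> r = \<zero>"
    and reg_y: "\<And>r s. r \<in> carrier R \<Longrightarrow> s \<in> carrier R \<Longrightarrow> r \<otimes> x \<oplus> s \<otimes> y = \<zero> \<Longrightarrow> \<exists>q\<in>carrier R. s = q \<otimes> x"
    and indep: "\<And>N r s. r \<in> carrier R \<Longrightarrow> s \<in> carrier R \<Longrightarrow>
      y [^] Suc N \<otimes> r \<noteq> z \<otimes> (x [^] N \<otimes> y [^] N) \<oplus> x [^] Suc N \<otimes> s"
    and T: "\<And>w. w \<in> T \<Longrightarrow> w \<in> carrier I1"
      "\<And>w. w \<in> T \<Longrightarrow> \<exists>N. x [^] Suc N \<odot>\<^bsub>I1\<^esub> w = \<zero>\<^bsub>I1\<^esub> \<and> y [^] Suc N \<odot>\<^bsub>I1\<^esub> w = \<zero>\<^bsub>I1\<^esub>"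
  shows "\<exists>d\<in>carrier I1. x \<odot>\<^bsub>I2\<^esub> \<delta>1 d = \<zero>\<^bsub>I2\<^esub> \<and> y \<odot>\<^bsub>I2\<^esub> \<delta>1 d = \<zero>\<^bsub>I2\<^esub> \<and> z \<odot>\<^bsub>I2\<^esub> \<delta>1 d \<notin> \<delta>1 ` T"
proof -
  have m0: "module R I0" and m1: "module R I1" using I0 I1 by (simp_all add: injective_module_def)
  interpret I0: module R I0 by fact
  interpret I1: module R I1 by fact
  interpret I2: module R I2 by fact
  have \<epsilon>c: "\<epsilon> r \<in> carrier I0" if "r \<in> carrier R" for r
    using mod_homD(1)[OF \<epsilon>] that by (simp add: regular_module_def)
  have \<epsilon>_add: "\<epsilon> (r \<oplus> s) = \<epsilon> r \<oplus>\<^bsub>I0\<^esub> \<epsilon> s" if "r \<in> carrier R" "s \<in> carrier R" for r s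
    using mod_homD(2)[OF \<epsilon>] that by (simp add: regular_module_def)
  have \<epsilon>_smult: "\<epsilon> (r \<otimes> s) = r \<odot>\<^bsub>I0\<^esub> \<epsilon> s" if "r \<in> carrier R" "s \<in> carrier R" for r s
    using mod_homD(3)[OF \<epsilon>] that by (simp add: regular_module_def)
  have \<delta>0_\<epsilon>: "\<delta>0 (\<epsilon> r) = \<zero>\<^bsub>I1\<^esub>" if "r \<in> carrier R" for r
    using ex0 that by (auto simp: mod_ker_def)
  \<comment> \<open>Here a plays the role of 1 / x. The second equation, 0 a = 0, is a dummy that
    lets the lemma for two equations divide by x alone.\<close>
  have "\<exists>a\<in>carrier I0. x \<odot>\<^bsub>I0\<^esub> a = \<epsilon> \<one> \<and> \<zero> \<odot>\<^bsub>I0\<^esub> a = \<zero>\<^bsub>I0\<^esub>"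
  proof (rule injective_module_solve_two[OF I0])
    fix r s assume rs: "r \<in> carrier R" "s \<in> carrier R" "r \<otimes> x \<oplus> s \<otimes> \<zero> = \<zero>"
    then have "r = \<zero>" using reg_x R by simp
    then show "r \<odot>\<^bsub>I0\<^esub> \<epsilon> \<one> \<oplus>\<^bsub>I0\<^esub> s \<odot>\<^bsub>I0\<^esub> \<zero>\<^bsub>I0\<^esub> = \<zero>\<^bsub>I0\<^esub>" using rs(2) \<epsilon>c by simp
  qed (use R \<epsilon>c in auto)
  then obtain a where a: "a \<in> carrier I0" "x \<odot>\<^bsub>I0\<^esub> a = \<epsilon> \<one>" by blast
  define c where "c = \<delta>0 a"
  have c: "c \<in> carrier I1" unfolding c_def using mod_homD(1)[OF \<delta>0 a(1)] .
  have xc: "x \<odot>\<^bsub>I1\<^esub> c = \<zero>\<^bsub>I1\<^esub>"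
    unfolding c_def using mod_homD(3)[OF \<delta>0 R(1) a(1)] a(2) \<delta>0_\<epsilon>[OF I0.R.one_closed] by simp
  \<comment> \<open>Solvability requires s c = 0 whenever r x + s y = 0. In that case s is a
    multiple of x, and x kills c because x a = \<epsilon> 1 is a cocycle.\<close>
  have "\<exists>d\<in>carrier I1. x \<odot>\<^bsub>I1\<^esub> d = \<zero>\<^bsub>I1\<^esub> \<and> y \<odot>\<^bsub>I1\<^esub> d = c"
  proof (rule injective_module_solve_two[OF I1])
    fix r s assume rs: "r \<in> carrier R" "s \<in> carrier R" "r \<otimes> x \<oplus> s \<otimes> y = \<zero>"
    then obtain q where q: "q \<in> carrier R" "s = q \<otimes> x" using reg_y by blast
    then have "s \<odot>\<^bsub>I1\<^esub> c = \<zero>\<^bsub>I1\<^esub>" using R c xc by (simp add: I1.smult_assoc1)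
    then show "r \<odot>\<^bsub>I1\<^esub> \<zero>\<^bsub>I1\<^esub> \<oplus>\<^bsub>I1\<^esub> s \<odot>\<^bsub>I1\<^esub> c = \<zero>\<^bsub>I1\<^esub>" using rs(1) by simp
  qed (use R c in auto)
  then obtain d where d: "d \<in> carrier I1" "x \<odot>\<^bsub>I1\<^esub> d = \<zero>\<^bsub>I1\<^esub>" "y \<odot>\<^bsub>I1\<^esub> d = c" by blast
  have "x \<odot>\<^bsub>I2\<^esub> \<delta>1 d = \<zero>\<^bsub>I2\<^esub>"
    using mod_homD(3)[OF \<delta>1 R(1) d(1)] d(2) mod_hom_zero[OF \<delta>1 m1 I2] by simp
  moreover have "c \<in> mod_ker I1 I2 \<delta>1" unfolding c_def ex1[symmetric] using a(1) by blast
  then have "y \<odot>\<^bsub>I2\<^esub> \<delta>1 d = \<zero>\<^bsub>I2\<^esub>"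
    using mod_homD(3)[OF \<delta>1 R(2) d(1)] d(3) by (simp add: mod_ker_def)
  moreover have "z \<odot>\<^bsub>I2\<^esub> \<delta>1 d \<notin> \<delta>1 ` T"
  proof
    assume "z \<odot>\<^bsub>I2\<^esub> \<delta>1 d \<in> \<delta>1 ` T"
    then obtain w where w: "w \<in> T" "z \<odot>\<^bsub>I2\<^esub> \<delta>1 d = \<delta>1 w" by blast
    have wc: "w \<in> carrier I1" using T(1) w(1) .
    obtain N where N: "x [^] Suc N \<odot>\<^bsub>I1\<^esub> w = \<zero>\<^bsub>I1\<^esub>" "y [^] Suc N \<odot>\<^bsub>I1\<^esub> w = \<zero>\<^bsub>I1\<^esub>"
      using T(2)[OF w(1)] by blast
    define P where "P = x [^] N"
    define Q where "Q = y [^] N"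
    have PQ: "P \<in> carrier R" "Q \<in> carrier R" using R by (simp_all add: P_def Q_def)
    have Suc: "x [^] Suc N = P \<otimes> x" "y [^] Suc N = Q \<otimes> y" by (simp_all add: P_def Q_def)
    note N = N[unfolded Suc]
    \<comment> \<open>A cocycle, hence equal to \<delta>0 q for some q. Multiplying by ring elements
      that kill w turns information about d into information about q.\<close>
    let ?p = "z \<odot>\<^bsub>I1\<^esub> d \<ominus>\<^bsub>I1\<^esub> w"
    have "\<delta>1 ?p = \<delta>1 (z \<odot>\<^bsub>I1\<^esub> d) \<ominus>\<^bsub>I2\<^esub> \<delta>1 w"
      using d(1) wc R by (intro mod_hom_minus[OF \<delta>1 m1 I2]) auto
    also have "\<dots> = \<zero>\<^bsub>I2\<^esub>"
      using w(2) mod_homD(3)[OF \<delta>1 R(3) d(1)] mod_homD(1)[OF \<delta>1 wc] by (simp add: a_minus_def I2.M.r_neg)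
    finally have "?p \<in> mod_ker I1 I2 \<delta>1" using d(1) wc R by (simp add: mod_ker_def)
    then obtain q where q: "q \<in> carrier I0" "\<delta>0 q = ?p" unfolding ex1[symmetric] by (metis imageE)
    have p_eq: "a' \<odot>\<^bsub>I1\<^esub> ?p = (z \<otimes> a') \<odot>\<^bsub>I1\<^esub> d" if "a' \<in> carrier R" "a' \<odot>\<^bsub>I1\<^esub> w = \<zero>\<^bsub>I1\<^esub>" for a'
    proof -
      have "a' \<odot>\<^bsub>I1\<^esub> ?p = a' \<odot>\<^bsub>I1\<^esub> (z \<odot>\<^bsub>I1\<^esub> d) \<ominus>\<^bsub>I1\<^esub> a' \<odot>\<^bsub>I1\<^esub> w"
        using that(1) d(1) wc R by (simp add: a_minus_def I1.smult_r_distr I1.smult_r_minus)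
      also have "\<dots> = a' \<odot>\<^bsub>I1\<^esub> (z \<odot>\<^bsub>I1\<^esub> d)"
      proof -
        have "\<ominus>\<^bsub>I1\<^esub> \<zero>\<^bsub>I1\<^esub> = \<zero>\<^bsub>I1\<^esub>" by (rule I1.M.minus_equality) simp_all
        then show ?thesis unfolding that(2) a_minus_def using that(1) d(1) R by simp
      qed
      finally show ?thesis using that(1) d(1) R by (simp add: I1.smult_assoc1[symmetric] I0.R.m_comm)
    qed
    \<comment> \<open>As x^(N+1) kills w and x d = 0, the element x^(N+1) q is a cocycle and so has
      the form \<epsilon> r.\<close>
    have "\<delta>0 ((P \<otimes> x) \<odot>\<^bsub>I0\<^esub> q) = (P \<otimes> x) \<odot>\<^bsub>I1\<^esub> ?p"
      using mod_homD(3)[OF \<delta>0 _ q(1), of "P \<otimes> x"] q(2) PQ R by simp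
    also have "\<dots> = (z \<otimes> (P \<otimes> x)) \<odot>\<^bsub>I1\<^esub> d"
      using N(1) PQ R by (intro p_eq) auto
    also have "\<dots> = (z \<otimes> P) \<odot>\<^bsub>I1\<^esub> (x \<odot>\<^bsub>I1\<^esub> d)"
      using PQ R d(1) by (simp add: I1.smult_assoc1 I0.R.m_assoc)
    finally have "\<delta>0 ((P \<otimes> x) \<odot>\<^bsub>I0\<^esub> q) = \<zero>\<^bsub>I1\<^esub>" using PQ R d(2) by simp
    then have "(P \<otimes> x) \<odot>\<^bsub>I0\<^esub> q \<in> mod_ker I0 I1 \<delta>0" using q(1) PQ R by (simp add: mod_ker_def)
    then obtain r where r: "r \<in> carrier R" "(P \<otimes> x) \<odot>\<^bsub>I0\<^esub> q = \<epsilon> r" unfolding ex0[symmetric] by blast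
    \<comment> \<open>As y^(N+1) kills w and y d = \<delta>0 a, the elements y^(N+1) q and z y^N a
      differ by some \<epsilon> s.\<close>
    let ?u = "(Q \<otimes> y) \<odot>\<^bsub>I0\<^esub> q" and ?v = "(z \<otimes> Q) \<odot>\<^bsub>I0\<^esub> a"
    have "\<delta>0 ?u = (Q \<otimes> y) \<odot>\<^bsub>I1\<^esub> ?p"
      using mod_homD(3)[OF \<delta>0 _ q(1), of "Q \<otimes> y"] q(2) PQ R by simp
    also have "\<dots> = (z \<otimes> (Q \<otimes> y)) \<odot>\<^bsub>I1\<^esub> d"
      using N(2) PQ R by (intro p_eq) auto
    also have "\<dots> = (z \<otimes> Q) \<odot>\<^bsub>I1\<^esub> c"
      using PQ R d(1) by (simp add: I1.smult_assoc1 I0.R.m_assoc d(3)[symmetric])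
    also have "\<dots> = \<delta>0 ?v"
      unfolding c_def using mod_homD(3)[OF \<delta>0 _ a(1), of "z \<otimes> Q"] PQ R by simp
    finally have uv: "\<delta>0 ?u = \<delta>0 ?v" .
    have uvc: "?u \<in> carrier I0" "?v \<in> carrier I0" using q(1) a(1) PQ R by simp_all
    have "\<delta>0 (?u \<ominus>\<^bsub>I0\<^esub> ?v) = \<zero>\<^bsub>I1\<^esub>"
      using mod_hom_minus[OF \<delta>0 m0 m1 uvc] uv mod_homD(1)[OF \<delta>0 uvc(2)] by (simp add: a_minus_def I1.M.r_neg)
    then have "?u \<ominus>\<^bsub>I0\<^esub> ?v \<in> mod_ker I0 I1 \<delta>0" using uvc by (simp add: mod_ker_def)
    then obtain s where s: "s \<in> carrier R" "?u \<ominus>\<^bsub>I0\<^esub> ?v = \<epsilon> s" unfolding ex0[symmetric] by blast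
    have u_eq: "?u = \<epsilon> s \<oplus>\<^bsub>I0\<^esub> ?v"
      unfolding s(2)[symmetric] using uvc by (simp only: a_minus_def I0.M.a_assoc I0.M.l_neg I0.M.a_inv_closed I0.M.r_zero)
    \<comment> \<open>Compute (x y)^(N+1) q in two ways. The relation x a = \<epsilon> 1 turns
      x^(N+1) z y^N a into \<epsilon> (z x^N y^N), and injectivity of \<epsilon> brings the equation
      down to R.\<close>
    have "\<epsilon> ((Q \<otimes> y) \<otimes> r) = (Q \<otimes> y) \<odot>\<^bsub>I0\<^esub> ((P \<otimes> x) \<odot>\<^bsub>I0\<^esub> q)"
      using r PQ R by (simp add: \<epsilon>_smult)
    also have "\<dots> = (P \<otimes> x) \<odot>\<^bsub>I0\<^esub> ?u"
      using PQ R q(1) by (simp only: I0.smult_assoc1[symmetric] I0.R.m_closed I0.R.m_comm)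
    also have "\<dots> = (P \<otimes> x) \<odot>\<^bsub>I0\<^esub> \<epsilon> s \<oplus>\<^bsub>I0\<^esub> (P \<otimes> x) \<odot>\<^bsub>I0\<^esub> ?v"
      unfolding u_eq using PQ R s(1) \<epsilon>c uvc by (intro I0.smult_r_distr) auto
    also have "(P \<otimes> x) \<odot>\<^bsub>I0\<^esub> ?v = (z \<otimes> (P \<otimes> Q)) \<odot>\<^bsub>I0\<^esub> (x \<odot>\<^bsub>I0\<^esub> a)"
    proof -
      have "(P \<otimes> x) \<otimes> (z \<otimes> Q) = (z \<otimes> (P \<otimes> Q)) \<otimes> x" using PQ R by (simp add: I0.R.m_ac)
      then show ?thesis using PQ R a(1) by (metis I0.smult_assoc1 I0.R.m_closed)
    qed
    also have "\<dots> = \<epsilon> (z \<otimes> (P \<otimes> Q))"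
      unfolding a(2) using \<epsilon>_smult[of "z \<otimes> (P \<otimes> Q)" \<one>] PQ R by simp
    also have "(P \<otimes> x) \<odot>\<^bsub>I0\<^esub> \<epsilon> s \<oplus>\<^bsub>I0\<^esub> \<epsilon> (z \<otimes> (P \<otimes> Q)) = \<epsilon> (z \<otimes> (P \<otimes> Q) \<oplus> (P \<otimes> x) \<otimes> s)"
      using PQ R s(1) \<epsilon>c by (simp add: \<epsilon>_add \<epsilon>_smult I0.M.a_comm)
    finally have "(Q \<otimes> y) \<otimes> r = z \<otimes> (P \<otimes> Q) \<oplus> (P \<otimes> x) \<otimes> s"
      using inj PQ R r(1) s(1) by (intro inj_onD[OF inj]) auto
    then show False using indep[OF r(1) s(1), of N] unfolding Suc by (simp add: P_def Q_def)
  qed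
  ultimately show ?thesis using d(1) by blast
qed

section \<open>Failure of rationality\<close>

lemma (in cring) ideal_power_ideal: "ideal J R \<Longrightarrow> ideal (ideal_power R J t) R"
  by (induction t) (auto intro: oneideal ideal_prod_is_ideal)

lemma (in cring) ideal_power_antimono:
  assumes "ideal J R" "s \<le> t" shows "ideal_power R J t \<subseteq> ideal_power R J s"
  using assms(2)
proof (rule lift_Suc_antimono_le[rotated])
  show "ideal_power R J (Suc n) \<subseteq> ideal_power R J n" for n
    using ideal_prod_inter[OF assms(1) ideal_power_ideal[OF assms(1)]] by simp
qed

lemma (in cring) pow_in_ideal_power:
  assumes "ideal J R" "x \<in> J" shows "x [^] (t::nat) \<in> ideal_power R J t"
proof (induction t)
  case (Suc t)
  have "x \<in> carrier R" using assms by (simp add: ideal.Icarr)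
  then have "x [^] Suc t = x \<otimes> x [^] t" by (simp add: m_comm)
  then show ?case using ideal_prod.prod[OF assms(2) Suc, of R] by simp
qed simp

lemma (in module) torsion_part_submodule:
  assumes J: "ideal J R" shows "submodule (torsion_part R J M) R M"
proof (rule submoduleI)
  note carr = ideal.Icarr[OF R.ideal_power_ideal[OF J]]
  show "torsion_part R J M \<subseteq> carrier M" by (auto simp: torsion_part_def)
  show "\<zero>\<^bsub>M\<^esub> \<in> torsion_part R J M" using carr by (auto simp: torsion_part_def)
  show "\<ominus>\<^bsub>M\<^esub> u \<in> torsion_part R J M" if u: "u \<in> torsion_part R J M" for u
  proof -
    obtain t where t: "u \<in> carrier M" "\<forall>a\<in>ideal_power R J t. a \<odot>\<^bsub>M\<^esub> u = \<zero>\<^bsub>M\<^esub>"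
      using u by (auto simp: torsion_part_def)
    have "\<ominus>\<^bsub>M\<^esub> \<zero>\<^bsub>M\<^esub> = \<zero>\<^bsub>M\<^esub>" by (rule M.minus_equality) simp_all
    then have "a \<odot>\<^bsub>M\<^esub> (\<ominus>\<^bsub>M\<^esub> u) = \<zero>\<^bsub>M\<^esub>" if "a \<in> ideal_power R J t" for a
      using smult_r_minus[OF carr[OF that] t(1)] t(2) that by metis
    then show ?thesis using t(1) by (auto simp: torsion_part_def)
  qed
  show "u \<oplus>\<^bsub>M\<^esub> v \<in> torsion_part R J M" if uv: "u \<in> torsion_part R J M" "v \<in> torsion_part R J M" for u v
  proof -
    obtain s t where s: "u \<in> carrier M" "\<forall>a\<in>ideal_power R J s. a \<odot>\<^bsub>M\<^esub> u = \<zero>\<^bsub>M\<^esub>"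
      and t: "v \<in> carrier M" "\<forall>a\<in>ideal_power R J t. a \<odot>\<^bsub>M\<^esub> v = \<zero>\<^bsub>M\<^esub>"
      using uv by (auto simp: torsion_part_def)
    have "a \<odot>\<^bsub>M\<^esub> (u \<oplus>\<^bsub>M\<^esub> v) = \<zero>\<^bsub>M\<^esub>" if a: "a \<in> ideal_power R J (max s t)" for a
    proof -
      have "a \<in> ideal_power R J s" "a \<in> ideal_power R J t"
        using a R.ideal_power_antimono[OF J, of s "max s t"] R.ideal_power_antimono[OF J, of t "max s t"]
        by auto
      then show ?thesis using s t carr[OF a] by (simp add: smult_r_distr)
    qed
    then show ?thesis using s(1) t(1) by (auto simp: torsion_part_def)
  qed
  show "r \<odot>\<^bsub>M\<^esub> u \<in> torsion_part R J M" if r: "r \<in> carrier R" and u: "u \<in> torsion_part R J M" for r u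
  proof -
    obtain t where t: "u \<in> carrier M" "\<forall>a\<in>ideal_power R J t. a \<odot>\<^bsub>M\<^esub> u = \<zero>\<^bsub>M\<^esub>"
      using u by (auto simp: torsion_part_def)
    have "a \<odot>\<^bsub>M\<^esub> (r \<odot>\<^bsub>M\<^esub> u) = \<zero>\<^bsub>M\<^esub>" if a: "a \<in> ideal_power R J t" for a
    proof -
      have "a \<odot>\<^bsub>M\<^esub> (r \<odot>\<^bsub>M\<^esub> u) = r \<odot>\<^bsub>M\<^esub> (a \<odot>\<^bsub>M\<^esub> u)"
        using carr[OF a] r t(1) by (metis smult_assoc1 R.m_comm)
      then show ?thesis using a r t(2) by simp
    qed
    then show ?thesis using r t(1) by (auto simp: torsion_part_def)
  qed
qed

lemma mod_hom_torsion_part: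
  assumes f: "f \<in> mod_hom R M N" and "module R M" "module R N" and J: "ideal J R"
    and u: "u \<in> torsion_part R J M"
  shows "f u \<in> torsion_part R J N"
proof -
  interpret M: module R M by fact
  obtain t where t: "u \<in> carrier M" "\<forall>a\<in>ideal_power R J t. a \<odot>\<^bsub>M\<^esub> u = \<zero>\<^bsub>M\<^esub>"
    using u by (auto simp: torsion_part_def)
  have "a \<odot>\<^bsub>N\<^esub> f u = \<zero>\<^bsub>N\<^esub>" if a: "a \<in> ideal_power R J t" for a
  proof -
    have "a \<in> carrier R" using a by (rule ideal.Icarr[OF M.R.ideal_power_ideal[OF J]])
    then have "a \<odot>\<^bsub>N\<^esub> f u = f (a \<odot>\<^bsub>M\<^esub> u)" using mod_homD(3)[OF f _ t(1)] by simp
    then show ?thesis using t(2) a mod_hom_zero[OF assms(1-3)] by simp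
  qed
  then show ?thesis using mod_homD(1)[OF f t(1)] by (auto simp: torsion_part_def)
qed

text \<open>The image of the residue class of 1 will do: the embedding is injective, and the maximal
  ideal kills the residue field.\<close>

lemma injective_hull_residue_socle:
  assumes hull: "injective_hull R (residue_module R \<mm>) E \<iota>" and max: "maximalideal \<mm> R"
  shows "\<exists>e\<in>carrier E. e \<noteq> \<zero>\<^bsub>E\<^esub> \<and> (\<forall>r\<in>\<mm>. r \<odot>\<^bsub>E\<^esub> e = \<zero>\<^bsub>E\<^esub>)"
proof -
  have E: "module R E" and \<iota>: "\<iota> \<in> mod_hom R (residue_module R \<mm>) E"
    and inj: "inj_on \<iota> (carrier (residue_module R \<mm>))"
    using hull by (auto simp: injective_hull_def injective_module_def)
  interpret E: module R E by fact
  interpret \<mm>: maximalideal \<mm> R by fact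
  interpret N: module R "regular_module R" by (rule E.R.regular_module_module)
  have \<mm>: "submodule \<mm> R (regular_module R)"
    by (rule E.R.ideal_submodule_regular_module) (rule \<mm>.is_ideal)
  note K = N.quotient_module_carrier[OF \<mm>] N.quotient_module_zero[OF \<mm>] N.quotient_module_smult[OF \<mm>]
    N.coset_eq_submodule_iff[OF \<mm>]
  let ?K = "residue_module R \<mm>"
  have Kmod: "module R ?K" unfolding residue_module_def by (rule N.quotient_module_module[OF \<mm>])
  have one: "\<one>\<^bsub>R\<^esub> \<in> carrier (regular_module R)" by (simp add: regular_module_def)
  let ?k = "\<mm> +>\<^bsub>regular_module R\<^esub> \<one>\<^bsub>R\<^esub>"
  have k: "?k \<in> carrier ?K" unfolding residue_module_def K(1) using one by blast
  have k0: "\<zero>\<^bsub>?K\<^esub> = \<mm>" by (simp add: residue_module_def K(2))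
  have "\<iota> ?k \<noteq> \<zero>\<^bsub>E\<^esub>"
  proof
    assume "\<iota> ?k = \<zero>\<^bsub>E\<^esub>"
    then have "\<iota> ?k = \<iota> \<zero>\<^bsub>?K\<^esub>" using mod_hom_zero[OF \<iota> Kmod E] by simp
    then have "?k = \<zero>\<^bsub>?K\<^esub>"
      by (rule inj_onD[OF inj]) (use k module.axioms(2)[OF Kmod] abelian_group.axioms(1) abelian_monoid.zero_closed in blast)+
    then have "\<one>\<^bsub>R\<^esub> \<in> \<mm>" unfolding k0 K(4)[OF one] .
    then show False using \<mm>.one_imp_carrier \<mm>.I_notcarr by simp
  qed
  moreover have "r \<odot>\<^bsub>E\<^esub> \<iota> ?k = \<zero>\<^bsub>E\<^esub>" if r: "r \<in> \<mm>" for r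
  proof -
    have rc: "r \<in> carrier R" using r by (rule \<mm>.Icarr)
    have "r \<odot>\<^bsub>?K\<^esub> ?k = \<mm> +>\<^bsub>regular_module R\<^esub> r"
      unfolding residue_module_def K(3)[OF rc one] using rc by (simp add: regular_module_def)
    also have "\<dots> = \<zero>\<^bsub>?K\<^esub>" using K(4)[of r] rc r k0 by (simp add: regular_module_def)
    finally show ?thesis using mod_homD(3)[OF \<iota> rc k] mod_hom_zero[OF \<iota> Kmod E] by simp
  qed
  ultimately show ?thesis using mod_homD(1)[OF \<iota> k] by blast
qed

text \<open>The hypotheses collect what the argument takes from the hypersurface: R is local, x, y
  is a regular sequence, the square of the maximal ideal lies in (x, y), and z M lies in (x, y) M.
  The condition \<open>indep\<close> says that z / (x y) is nonzero in the direct limit of the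
  quotients R / (x^n, y^n).\<close>

theorem not_cl_rational_module_closure:
  fixes R (structure)
  assumes max: "maximalideal \<mm> R"
    and units: "\<And>r. r \<in> carrier R \<Longrightarrow> r \<notin> \<mm> \<Longrightarrow> r \<in> Units R"
    and xy: "x \<in> \<mm>" "y \<in> \<mm>" and z: "z \<in> carrier R"
    and \<mm>2: "\<And>a b. a \<in> \<mm> \<Longrightarrow> b \<in> \<mm> \<Longrightarrow> \<exists>r\<in>carrier R. \<exists>s\<in>carrier R. a \<otimes> b = r \<otimes> x \<oplus> s \<otimes> y"
    and reg_x: "\<And>r. r \<in> carrier R \<Longrightarrow> r \<otimes> x = \<zero> \<Longrightarrow> r = \<zero>"
    and reg_y: "\<And>r s. r \<in> carrier R \<Longrightarrow> s \<in> carrier R \<Longrightarrow> r \<otimes> x \<oplus> s \<otimes> y = \<zero> \<Longrightarrow> \<exists>q\<in>carrier R. s = q \<otimes> x"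
    and indep: "\<And>N r s. r \<in> carrier R \<Longrightarrow> s \<in> carrier R \<Longrightarrow>
      y [^] Suc N \<otimes> r \<noteq> z \<otimes> (x [^] N \<otimes> y [^] N) \<oplus> x [^] Suc N \<otimes> s"
    and M: "module R M"
    and zM: "\<And>b. b \<in> carrier M \<Longrightarrow> \<exists>b1\<in>carrier M. \<exists>b2\<in>carrier M. z \<odot>\<^bsub>M\<^esub> b = x \<odot>\<^bsub>M\<^esub> b1 \<oplus>\<^bsub>M\<^esub> y \<odot>\<^bsub>M\<^esub> b2"
    and res: "injective_resolution R (regular_module R) I \<epsilon> \<delta>"
    and hull: "injective_hull R (residue_module R \<mm>) E \<iota>"
  shows "\<not> cl_rational R (module_closure R M) (local_cohomology R \<mm> I \<delta> 2) E"
proof -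
  have E: "injective_module R E" using hull by (simp add: injective_hull_def)
  then have Em: "module R E" by (simp add: injective_module_def)
  have I: "injective_module R (I n)" for n using res by (simp add: injective_resolution_def)
  then have Im: "module R (I n)" for n by (simp add: injective_module_def)
  interpret E: module R E by (rule Em)
  interpret I1: module R "I (Suc 0)" by (rule Im)
  interpret I2: module R "I 2" by (rule Im)
  interpret \<mm>: maximalideal \<mm> R by (rule max)
  have \<mm>i: "ideal \<mm> R" by (rule \<mm>.is_ideal)
  have xyc: "x \<in> carrier R" "y \<in> carrier R" using xy by (auto intro: \<mm>.Icarr)
  have \<delta>: "\<delta> n \<in> mod_hom R (I n) (I (Suc n))" for n using res by (simp add: injective_resolution_def)
  have ex: "\<delta> n ` carrier (I n) = mod_ker (I (Suc n)) (I (Suc (Suc n))) (\<delta> (Suc n))" for n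
    using res by (simp add: injective_resolution_def)
  have two: "Suc (Suc 0) = 2" and three: "Suc 2 = 3" by simp_all
  define T where "T n = torsion_part R \<mm> (I n)" for n
  have Tsub: "submodule (T n) R (I n)" for n unfolding T_def by (rule module.torsion_part_submodule[OF Im \<mm>i])
  have "\<exists>d\<in>carrier (I (Suc 0)). x \<odot>\<^bsub>I 2\<^esub> \<delta> (Suc 0) d = \<zero>\<^bsub>I 2\<^esub> \<and> y \<odot>\<^bsub>I 2\<^esub> \<delta> (Suc 0) d = \<zero>\<^bsub>I 2\<^esub> \<and>
      z \<odot>\<^bsub>I 2\<^esub> \<delta> (Suc 0) d \<notin> \<delta> (Suc 0) ` T (Suc 0)"
  proof (rule injective_resolution_nonzero_class[OF I[of 0] I[of "Suc 0"] Im[of 2]])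
    show "\<epsilon> \<in> mod_hom R (regular_module R) (I 0)" using res by (simp add: injective_resolution_def)
    show "inj_on \<epsilon> (carrier R)" using res by (simp add: injective_resolution_def regular_module_def)
    show "\<delta> 0 \<in> mod_hom R (I 0) (I (Suc 0))" by (rule \<delta>)
    show "\<delta> (Suc 0) \<in> mod_hom R (I (Suc 0)) (I 2)" using \<delta>[of "Suc 0"] unfolding two .
    show "\<epsilon> ` carrier R = mod_ker (I 0) (I (Suc 0)) (\<delta> 0)"
      using res by (simp add: injective_resolution_def regular_module_def)
    show "\<delta> 0 ` carrier (I 0) = mod_ker (I (Suc 0)) (I 2) (\<delta> (Suc 0))" using ex[of 0] unfolding two .
    show "w \<in> carrier (I (Suc 0))" if "w \<in> T (Suc 0)" for w using that by (simp add: T_def torsion_part_def)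
    show "\<exists>N. x [^] Suc N \<odot>\<^bsub>I (Suc 0)\<^esub> w = \<zero>\<^bsub>I (Suc 0)\<^esub> \<and> y [^] Suc N \<odot>\<^bsub>I (Suc 0)\<^esub> w = \<zero>\<^bsub>I (Suc 0)\<^esub>"
      if w: "w \<in> T (Suc 0)" for w
    proof -
      obtain t where t: "\<forall>a\<in>ideal_power R \<mm> t. a \<odot>\<^bsub>I (Suc 0)\<^esub> w = \<zero>\<^bsub>I (Suc 0)\<^esub>"
        using w by (auto simp: T_def torsion_part_def)
      \<comment> \<open>If the t-th power of the maximal ideal kills w, so do x^(t+1) and y^(t+1);
        the successor matches the exponents in \<open>indep\<close>.\<close>
      have "a [^] Suc t \<in> ideal_power R \<mm> t" if "a \<in> \<mm>" for a
        using E.R.pow_in_ideal_power[OF \<mm>i that, of "Suc t"] E.R.ideal_power_antimono[OF \<mm>i, of t "Suc t"]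
        by auto
      then show ?thesis using t xy by blast
    qed
  qed (fact xyc z reg_x reg_y indep)+
  then obtain d where d: "d \<in> carrier (I (Suc 0))" "x \<odot>\<^bsub>I 2\<^esub> \<delta> (Suc 0) d = \<zero>\<^bsub>I 2\<^esub>"
    "y \<odot>\<^bsub>I 2\<^esub> \<delta> (Suc 0) d = \<zero>\<^bsub>I 2\<^esub>" "z \<odot>\<^bsub>I 2\<^esub> \<delta> (Suc 0) d \<notin> \<delta> (Suc 0) ` T (Suc 0)"
    by blast
  \<comment> \<open>A representative of [1 / (x y)]. It is a coboundary of the resolution, hence a
    cocycle; its class can survive in the torsion complex because d need not be torsion.\<close>
  define v where "v = \<delta> (Suc 0) d"
  define B where "B = \<delta> (Suc 0) ` T (Suc 0)"
  define Z where "Z = {u \<in> T 2. \<delta> 2 u = \<zero>\<^bsub>I 3\<^esub>}"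
  let ?N = "(I 2)\<lparr>carrier := Z\<rparr>"
  let ?H = "quotient_module ?N B"
  note \<delta>1 = \<delta>[of "Suc 0", unfolded two] and \<delta>2 = \<delta>[of 2, unfolded three]
  have H: "local_cohomology R \<mm> I \<delta> 2 = ?H"
    by (simp add: local_cohomology_def Z_def B_def T_def numeral_2_eq_2 numeral_3_eq_3)
  have \<delta>\<delta>: "\<delta> 2 (\<delta> (Suc 0) w) = \<zero>\<^bsub>I 3\<^esub>" if "w \<in> carrier (I (Suc 0))" for w
  proof -
    have "\<delta> (Suc 0) w \<in> mod_ker (I 2) (I 3) (\<delta> 2)"
      using ex[of "Suc 0"] that unfolding two three by blast
    then show ?thesis by (simp add: mod_ker_def)
  qed
  have Zsub: "submodule Z R (I 2)"
  proof (rule I2.submoduleI)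
    note T2 = I2.submoduleE[OF Tsub[of 2]]
    interpret I3: module R "I 3" by (rule Im)
    show "Z \<subseteq> carrier (I 2)" using T2(1) by (auto simp: Z_def)
    show "\<zero>\<^bsub>I 2\<^esub> \<in> Z"
      using I2.submodule_zero[OF Tsub] mod_hom_zero[OF \<delta>2 Im Im] by (simp add: Z_def)
    show "u \<oplus>\<^bsub>I 2\<^esub> u' \<in> Z" if "u \<in> Z" "u' \<in> Z" for u u'
      using that T2(1,5) mod_homD(2)[OF \<delta>2, of u u'] by (auto simp: Z_def)
    show smult: "a \<odot>\<^bsub>I 2\<^esub> u \<in> Z" if "a \<in> carrier R" "u \<in> Z" for a u
      using that T2(1,4) mod_homD(3)[OF \<delta>2, of a u] by (auto simp: Z_def)
    show "\<ominus>\<^bsub>I 2\<^esub> u \<in> Z" if "u \<in> Z" for u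
      using smult[of "\<ominus> \<one>" u] that T2(1) by (auto simp: Z_def I2.smult_l_minus)
  qed
  have N: "module R ?N" by (rule submodule.submodule_is_module[OF Zsub Im])
  interpret N: module R ?N by (rule N)
  have T1c: "w \<in> carrier (I (Suc 0))" if "w \<in> T (Suc 0)" for w using that by (simp add: T_def torsion_part_def)
  have BZ: "B \<subseteq> Z"
    using mod_hom_torsion_part[OF \<delta>1 Im Im \<mm>i] \<delta>\<delta> T1c by (auto simp: B_def Z_def T_def)
  have Bsub: "submodule B R ?N"
  proof (rule N.submoduleI)
    note T1 = I1.submoduleE[OF Tsub[of "Suc 0"]]
    show "B \<subseteq> carrier ?N" using BZ by simp
    show "\<zero>\<^bsub>?N\<^esub> \<in> B"
      using imageI[OF I1.submodule_zero[OF Tsub], of "\<delta> (Suc 0)"] mod_hom_zero[OF \<delta>1 Im Im] by (simp add: B_def)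
    show "u \<oplus>\<^bsub>?N\<^esub> u' \<in> B" if uu: "u \<in> B" "u' \<in> B" for u u'
    proof -
      obtain w w' where w: "w \<in> T (Suc 0)" "w' \<in> T (Suc 0)" "u = \<delta> (Suc 0) w" "u' = \<delta> (Suc 0) w'"
        using uu by (auto simp: B_def)
      then have "u \<oplus>\<^bsub>?N\<^esub> u' = \<delta> (Suc 0) (w \<oplus>\<^bsub>I (Suc 0)\<^esub> w')"
        using mod_homD(2)[OF \<delta>1 T1c T1c] by simp
      then show ?thesis using T1(5)[OF w(1,2)] by (simp add: B_def)
    qed
    show smult: "a \<odot>\<^bsub>?N\<^esub> u \<in> B" if a: "a \<in> carrier R" and u: "u \<in> B" for a u
    proof -
      obtain w where w: "w \<in> T (Suc 0)" "u = \<delta> (Suc 0) w" using u by (auto simp: B_def)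
      then have "a \<odot>\<^bsub>?N\<^esub> u = \<delta> (Suc 0) (a \<odot>\<^bsub>I (Suc 0)\<^esub> w)"
        using mod_homD(3)[OF \<delta>1 a T1c] by simp
      then show ?thesis using T1(4)[OF a w(1)] by (simp add: B_def)
    qed
    show "\<ominus>\<^bsub>?N\<^esub> u \<in> B" if u: "u \<in> B" for u
    proof -
      have "\<ominus> \<one> \<odot>\<^bsub>?N\<^esub> u = \<ominus>\<^bsub>?N\<^esub> u"
        using N.smult_l_minus[OF E.R.one_closed, of u] N.smult_one[of u] u BZ by auto
      then show ?thesis using smult[OF _ u, of "\<ominus> \<one>"] by simp
    qed
  qed
  have vc: "v \<in> carrier (I 2)" unfolding v_def using mod_homD(1)[OF \<delta>1 d(1)] .
  \<comment> \<open>Here v is shown to be torsion, with exponent 2: x and y kill it, and products of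
    two elements of the maximal ideal lie in (x, y). The innermost factor \<open>carrier R\<close>
    in the unfolded power is absorbed by the ideal.\<close>
  have "a \<odot>\<^bsub>I 2\<^esub> v = \<zero>\<^bsub>I 2\<^esub>" if "a \<in> ideal_power R \<mm> 2" for a
  proof -
    have "a \<in> ideal_prod R \<mm> (ideal_prod R \<mm> (carrier R))" using that by (simp add: numeral_2_eq_2)
    then have "a \<in> carrier R \<and> a \<odot>\<^bsub>I 2\<^esub> v = \<zero>\<^bsub>I 2\<^esub>"
    proof (induction rule: ideal_prod.induct)
      case (prod i j)
      have j: "j \<in> \<mm>" using prod(2) E.R.ideal_prod_inter[OF \<mm>i E.R.oneideal] by blast
      obtain r s where rs: "r \<in> carrier R" "s \<in> carrier R" "i \<otimes> j = r \<otimes> x \<oplus> s \<otimes> y"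
        using \<mm>2[OF prod(1) j] by blast
      show ?case
        unfolding rs(3) using rs(1,2) xyc vc d(2,3)
        by (simp add: I2.smult_l_distr I2.smult_assoc1 flip: v_def)
    next
      case (sum s1 s2)
      then show ?case using vc by (simp add: I2.smult_l_distr)
    qed
    then show ?thesis by simp
  qed
  then have vZ: "v \<in> Z" using vc \<delta>\<delta>[OF d(1)] by (auto simp: Z_def T_def torsion_part_def v_def)
  define w where "w = z \<odot>\<^bsub>I 2\<^esub> v"
  have wZ: "w \<in> Z" unfolding w_def using submodule.smult_closed[OF Zsub z vZ] .
  have wB: "w \<notin> B" using d(4) by (simp add: w_def v_def B_def)
  obtain e where e: "e \<in> carrier E" "e \<noteq> \<zero>\<^bsub>E\<^esub>" "\<And>r. r \<in> \<mm> \<Longrightarrow> r \<odot>\<^bsub>E\<^esub> e = \<zero>\<^bsub>E\<^esub>"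
    using injective_hull_residue_socle[OF hull max] by blast
  have "\<exists>f\<in>mod_hom R ?H E. f (B +>\<^bsub>?N\<^esub> w) = e"
  proof (rule nonzero_hom_to_injective_module[OF E N Bsub])
    fix r assume r: "r \<in> carrier R" "r \<odot>\<^bsub>?N\<^esub> w \<in> B"
    \<comment> \<open>A unit cannot carry w into \<open>B\<close>, as w itself is outside. So every
      r with r w in \<open>B\<close> lies in the maximal ideal, which kills e.\<close>
    have "r \<in> \<mm>"
    proof (rule ccontr)
      assume "r \<notin> \<mm>"
      then have u: "r \<in> Units R" using units r(1) by blast
      have "inv r \<odot>\<^bsub>?N\<^esub> (r \<odot>\<^bsub>?N\<^esub> w) \<in> B" using N.submoduleE(4)[OF Bsub _ r(2)] u by simp
      moreover have "inv r \<odot>\<^bsub>?N\<^esub> (r \<odot>\<^bsub>?N\<^esub> w) = w"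
        using N.smult_assoc1[of "inv r" r w] N.smult_one[of w] u r(1) wZ by simp
      ultimately show False using wB by simp
    qed
    then show "r \<odot>\<^bsub>E\<^esub> e = \<zero>\<^bsub>E\<^esub>" by (rule e(3))
  qed (use wZ e(1) in auto)
  then obtain f where f: "f \<in> mod_hom R ?H E" "f (B +>\<^bsub>?N\<^esub> w) = e" by blast
  have Hm: "module R ?H" by (rule N.quotient_module_module[OF Bsub])
  interpret H: module R ?H by (rule Hm)
  let ?\<eta> = "B +>\<^bsub>?N\<^esub> v"
  have \<eta>: "?\<eta> \<in> carrier ?H" unfolding N.quotient_module_carrier[OF Bsub] using vZ by auto
  have kill: "a \<odot>\<^bsub>?H\<^esub> ?\<eta> = \<zero>\<^bsub>?H\<^esub>" if a: "a \<in> carrier R" "a \<odot>\<^bsub>I 2\<^esub> v = \<zero>\<^bsub>I 2\<^esub>" for a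
  proof -
    have "a \<odot>\<^bsub>?H\<^esub> ?\<eta> = B +>\<^bsub>?N\<^esub> \<zero>\<^bsub>?N\<^esub>" using N.quotient_module_smult[OF Bsub a(1), of v] vZ a(2) by simp
    also have "\<dots> = B"
      using N.coset_eq_submodule_iff[OF Bsub N.M.zero_closed] N.submodule_zero[OF Bsub] by simp
    finally show ?thesis by (simp add: N.quotient_module_zero[OF Bsub])
  qed
  have w_eq: "B +>\<^bsub>?N\<^esub> w = z \<odot>\<^bsub>?H\<^esub> ?\<eta>"
    using N.quotient_module_smult[OF Bsub z, of v] vZ by (simp add: w_def)
  have "z \<odot>\<^bsub>?H\<^esub> ?\<eta> \<in> module_closure R M ?H {\<zero>\<^bsub>?H\<^esub>}"
  proof (rule module_closure_zeroI[OF M Hm])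
    show "z \<odot>\<^bsub>?H\<^esub> ?\<eta> \<in> carrier ?H" using z \<eta> by (rule H.smult_closed)
    fix b assume b: "b \<in> carrier M"
    obtain b1 b2 where bb: "b1 \<in> carrier M" "b2 \<in> carrier M" "z \<odot>\<^bsub>M\<^esub> b = x \<odot>\<^bsub>M\<^esub> b1 \<oplus>\<^bsub>M\<^esub> y \<odot>\<^bsub>M\<^esub> b2"
      using zM[OF b] by blast
    show "frag_of (b, z \<odot>\<^bsub>?H\<^esub> ?\<eta>) \<in> tensor_relations R M ?H"
      by (rule tensor_relations_frag_annihilated[OF M Hm xyc z \<eta> kill kill b bb])
        (use xyc d(2,3) in \<open>simp_all add: v_def\<close>)
  qed
  then have "f \<notin> tau_cl R (module_closure R M) ?H E" using f(2) e(2) unfolding w_eq tau_cl_def by auto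
  then show ?thesis unfolding H cl_rational_def using f(1) by auto
qed

section \<open>The hypersurface ring\<close>

lemma fps_dvd_one_iff:
  fixes p :: "'a::comm_ring_1 fps"
  shows "p dvd 1 \<longleftrightarrow> p $ 0 dvd 1"
proof
  assume "p dvd 1"
  then obtain q where "1 = p * q" by (rule dvdE)
  then have "1 = p $ 0 * q $ 0" by (metis fps_mult_nth_0 fps_one_nth)
  then show "p $ 0 dvd 1" by (rule dvdI)
next
  assume "p $ 0 dvd 1"
  then obtain c where "1 = p $ 0 * c" by (rule dvdE)
  then have "p * fps_right_inverse p c = 1" by (intro fps_right_inverse) simp
  then show "p dvd 1" by (metis dvd_triv_left)
qed

lemma ring_of_type_algebra_simps:
  "carrier (ring_of_type_algebra :: 'a::ring_1 ring) = UNIV"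
  "a \<otimes>\<^bsub>ring_of_type_algebra\<^esub> b = (a * b :: 'a::ring_1)"
  "a \<oplus>\<^bsub>ring_of_type_algebra\<^esub> b = (a + b :: 'a::ring_1)"
  "\<one>\<^bsub>ring_of_type_algebra\<^esub> = (1 :: 'a::ring_1)"
  "\<zero>\<^bsub>ring_of_type_algebra\<^esub> = (0 :: 'a::ring_1)"
  by (simp_all add: ring_of_type_algebra_def)

lemma ideal_of_type_algebraI:
  fixes J :: "'a::comm_ring_1 set"
  assumes "0 \<in> J" "\<And>a b. a \<in> J \<Longrightarrow> b \<in> J \<Longrightarrow> a + b \<in> J" "\<And>r a. a \<in> J \<Longrightarrow> r * a \<in> J"
  shows "ideal J ring_of_type_algebra"
proof -
  interpret P: cring "ring_of_type_algebra :: 'a ring" by (rule cring_from_type_algebra)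
  have minus: "- a \<in> J" if "a \<in> J" for a using assms(3)[OF that, of "- 1"] by simp
  have neg: "\<ominus>\<^bsub>ring_of_type_algebra\<^esub> a = - a" for a :: 'a
    by (rule P.minus_equality) (simp_all add: ring_of_type_algebra_simps)
  show ?thesis
  proof (rule idealI)
    show "ring (ring_of_type_algebra :: 'a ring)" by (rule ring_from_type_algebra)
    show "subgroup J (add_monoid (ring_of_type_algebra :: 'a ring))"
      by (rule P.add.subgroupI) (use assms minus in \<open>auto simp: ring_of_type_algebra_simps neg\<close>)
  qed (use assms(3) in \<open>auto simp: ring_of_type_algebra_simps mult.commute\<close>)
qed

text \<open>The series without constant term form an ideal containing x and y, hence containing
  \<open>ideal_xy\<close>.\<close>

lemma ideal_xy_decomp:
  assumes "s \<in> ideal_xy" shows "\<exists>a b. s = var_x * a + var_y * b"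
proof -
  interpret P: cring "ring_of_type_algebra :: 'a fps fps ring" by (rule cring_from_type_algebra)
  have "ideal_xy \<subseteq> {s :: 'a fps fps. s $ 0 $ 0 = 0}"
    unfolding ideal_xy_def
    by (intro P.genideal_minimal ideal_of_type_algebraI) (auto simp: var_x_def var_y_def)
  then show ?thesis using assms by (intro in_ideal_xy_decomp) auto
qed

lemma ADE_equation_const_coeff: "ADE_equation g \<Longrightarrow> g $ 0 $ 0 = 0"
  unfolding ADE_equation_def var_x_def var_y_def
  by (auto simp: fps_power_zeroth power_0_left)

section \<open>Residue classes modulo z^2 + g\<close>

context
  fixes g :: "'k::field fps fps"
begin

lemma mem_hypersurface_ideal: "p \<in> hypersurface_ideal g \<longleftrightarrow> var_z ^ 2 + fps_const g dvd p"
  by (auto simp: hypersurface_ideal_def cgenideal_def ring_of_type_algebra_simps dvd_def mult.commute)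

lemma hypersurface_ideal_ideal: "ideal (hypersurface_ideal g) ring_of_type_algebra"
  by (rule ideal_of_type_algebraI) (auto simp: mem_hypersurface_ideal)

lemma residue_class_eq: "residue_class g p = {q. var_z ^ 2 + fps_const g dvd q - p}"
proof -
  have "q \<in> residue_class g p \<longleftrightarrow> q - p \<in> hypersurface_ideal g" for q
    unfolding residue_class_def a_r_coset_def' by (force simp: ring_of_type_algebra_simps)
  then show ?thesis by (auto simp: mem_hypersurface_ideal)
qed

lemma residue_class_eq_iff:
  "residue_class g p = residue_class g q \<longleftrightarrow> var_z ^ 2 + fps_const g dvd p - q"
proof
  have "p \<in> residue_class g p" by (simp add: residue_class_eq)
  moreover assume "residue_class g p = residue_class g q"
  ultimately have "p \<in> residue_class g q" by simp
  then show "var_z ^ 2 + fps_const g dvd p - q" by (simp add: residue_class_eq)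
next
  assume pq: "var_z ^ 2 + fps_const g dvd p - q"
  have "var_z ^ 2 + fps_const g dvd r - p \<longleftrightarrow> var_z ^ 2 + fps_const g dvd r - q" for r
    using dvd_add_left_iff[OF pq, of "r - p"] by simp
  then show "residue_class g p = residue_class g q" by (simp add: residue_class_eq)
qed

lemma hypersurface_ring_cring: "cring (hypersurface_ring g)"
  unfolding hypersurface_ring_def
  by (rule ideal.quotient_is_cring[OF hypersurface_ideal_ideal cring_from_type_algebra])

lemma residue_class_hom: "residue_class g \<in> Ring.ring_hom ring_of_type_algebra (hypersurface_ring g)"
  using ideal.rcos_ring_hom[OF hypersurface_ideal_ideal]
  unfolding hypersurface_ring_def residue_class_def[abs_def] .

lemma hypersurface_ring_carrier: "carrier (hypersurface_ring g) = range (residue_class g)"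
  unfolding hypersurface_ring_def FactRing_def residue_class_def[abs_def]
  by (auto simp: A_RCOSETS_def' ring_of_type_algebra_simps)

lemma residue_class_ops:
  "residue_class g (p + q) = residue_class g p \<oplus>\<^bsub>hypersurface_ring g\<^esub> residue_class g q"
  "residue_class g (p * q) = residue_class g p \<otimes>\<^bsub>hypersurface_ring g\<^esub> residue_class g q"
  "residue_class g 1 = \<one>\<^bsub>hypersurface_ring g\<^esub>"
  "residue_class g 0 = \<zero>\<^bsub>hypersurface_ring g\<^esub>"
proof -
  note h = residue_class_hom
  show "residue_class g (p + q) = residue_class g p \<oplus>\<^bsub>hypersurface_ring g\<^esub> residue_class g q"
    using Ring.ring_hom_add[OF h, of p q] by (simp add: ring_of_type_algebra_simps)
  show "residue_class g (p * q) = residue_class g p \<otimes>\<^bsub>hypersurface_ring g\<^esub> residue_class g q"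
    using Ring.ring_hom_mult[OF h, of p q] by (simp add: ring_of_type_algebra_simps)
  show "residue_class g 1 = \<one>\<^bsub>hypersurface_ring g\<^esub>"
    using Ring.ring_hom_one[OF h] by (simp add: ring_of_type_algebra_simps)
  show "residue_class g 0 = \<zero>\<^bsub>hypersurface_ring g\<^esub>"
    using Ring.ring_hom_zero[OF h ring_from_type_algebra cring.axioms(1)[OF hypersurface_ring_cring]]
    by (simp add: ring_of_type_algebra_simps)
qed

lemma residue_class_in_carrier: "residue_class g p \<in> carrier (hypersurface_ring g)"
  by (simp add: hypersurface_ring_carrier)

lemma residue_class_pow: "residue_class g (p ^ n) = residue_class g p [^]\<^bsub>hypersurface_ring g\<^esub> n"
proof (induction n)
  case (Suc n)
  interpret R: cring "hypersurface_ring g" by (rule hypersurface_ring_cring)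
  show ?case using Suc by (simp add: residue_class_ops R.m_comm residue_class_in_carrier)
qed (simp add: residue_class_ops)

lemma residue_class_sum:
  assumes "finite A"
  shows "residue_class g (\<Sum>j\<in>A. f j) = (\<Oplus>\<^bsub>hypersurface_ring g\<^esub>j\<in>A. residue_class g (f j))"
  using assms
proof induction
  case empty
  interpret R: cring "hypersurface_ring g" by (rule hypersurface_ring_cring)
  show ?case by (simp add: residue_class_ops)
next
  case (insert j A)
  interpret R: cring "hypersurface_ring g" by (rule hypersurface_ring_cring)
  have "(\<lambda>j. residue_class g (f j)) \<in> A \<rightarrow> carrier (hypersurface_ring g)"
    by (simp add: residue_class_in_carrier)
  with insert show ?case
    by (simp add: residue_class_ops R.finsum_insert residue_class_in_carrier)
qed

lemma residue_class_eq_zero_iff: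
  "residue_class g p = \<zero>\<^bsub>hypersurface_ring g\<^esub> \<longleftrightarrow> var_z ^ 2 + fps_const g dvd p"
  using residue_class_eq_iff[of p 0] by (simp add: residue_class_ops)

lemma residue_class_unit:
  assumes "p $ 0 $ 0 $ 0 \<noteq> 0"
  shows "residue_class g p \<in> Units (hypersurface_ring g)"
proof -
  interpret R: cring "hypersurface_ring g" by (rule hypersurface_ring_cring)
  have "p dvd 1" using assms by (simp add: fps_dvd_one_iff)
  then obtain q where "1 = p * q" by (rule dvdE)
  then have "residue_class g p \<otimes>\<^bsub>hypersurface_ring g\<^esub> residue_class g q = \<one>\<^bsub>hypersurface_ring g\<^esub>"
    by (metis residue_class_ops(2,3))
  then show ?thesis by (metis R.Units_one_closed R.m_comm R.unit_factor residue_class_in_carrier)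
qed

context
  assumes g0: "g $ 0 $ 0 = 0"
begin

text \<open>The equation vanishes at the origin, so the constant coefficient of a series depends
  only on its class in R.\<close>

lemma const_coeff_eq_if_residue_class_eq:
  assumes "residue_class g p = residue_class g q"
  shows "p $ 0 $ 0 $ 0 = q $ 0 $ 0 $ 0"
proof -
  from assms obtain h where "p - q = (var_z ^ 2 + fps_const g) * h"
    unfolding residue_class_eq_iff by (rule dvdE)
  then have "(p - q) $ 0 $ 0 $ 0 = ((var_z ^ 2 + fps_const g) * h) $ 0 $ 0 $ 0" by simp
  then show ?thesis using g0 by (simp add: var_z_def)
qed

text \<open>A class with nonzero constant coefficient is a unit, so it lies in no maximal ideal. The
  remaining classes form a proper ideal containing the given one, and maximality forces
  equality.\<close>

lemma maximalideal_hypersurface_ring: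
  assumes "maximalideal \<mm> (hypersurface_ring g)"
  shows "\<mm> = residue_class g ` {p. p $ 0 $ 0 $ 0 = 0}"
proof -
  interpret R: cring "hypersurface_ring g" by (rule hypersurface_ring_cring)
  interpret \<mm>: maximalideal \<mm> "hypersurface_ring g" by fact
  let ?J = "residue_class g ` {p. p $ 0 $ 0 $ 0 = 0}"
  have minus: "\<ominus>\<^bsub>hypersurface_ring g\<^esub> residue_class g p = residue_class g (- p)" for p
    by (rule R.minus_equality) (simp_all add: residue_class_in_carrier flip: residue_class_ops)
  have "ideal ?J (hypersurface_ring g)"
  proof (rule idealI)
    show "subgroup ?J (add_monoid (hypersurface_ring g))"
    proof (rule R.add.subgroupI)
      show "?J \<noteq> {}" by (auto intro: exI[of _ 0])
    qed (auto simp: residue_class_in_carrier minus simp flip: residue_class_ops)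
  qed (auto simp: hypersurface_ring_carrier R.ring_axioms simp flip: residue_class_ops)
  moreover have "\<mm> \<subseteq> ?J"
  proof
    fix U assume U: "U \<in> \<mm>"
    then obtain p where p: "U = residue_class g p" using \<mm>.Icarr by (auto simp: hypersurface_ring_carrier)
    have "p $ 0 $ 0 $ 0 = 0"
    proof (rule ccontr)
      assume "p $ 0 $ 0 $ 0 \<noteq> 0"
      then have "U \<in> Units (hypersurface_ring g)" unfolding p by (rule residue_class_unit)
      then have "\<one>\<^bsub>hypersurface_ring g\<^esub> \<in> \<mm>"
        using \<mm>.I_l_closed[OF U R.Units_inv_closed] by (metis R.Units_l_inv)
      then show False using \<mm>.one_imp_carrier \<mm>.I_notcarr by simp
    qed
    then show "U \<in> ?J" using p by blast
  qed
  moreover have "?J \<noteq> carrier (hypersurface_ring g)"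
  proof
    assume "?J = carrier (hypersurface_ring g)"
    then have "residue_class g 1 \<in> ?J" by (simp add: residue_class_in_carrier)
    then obtain p where "residue_class g 1 = residue_class g p" "p $ 0 $ 0 $ 0 = 0" by blast
    then show False using const_coeff_eq_if_residue_class_eq[of 1 p] by simp
  qed
  moreover have "?J \<subseteq> carrier (hypersurface_ring g)" by (auto simp: residue_class_in_carrier)
  ultimately show ?thesis using \<mm>.I_maximal[of ?J] by blast
qed

text \<open>Modulo (x, y) both factors are multiples of z, and z^2 = - g lies in (x, y).\<close>

lemma residue_class_mult_in_xy:
  assumes "p $ 0 $ 0 $ 0 = 0" "q $ 0 $ 0 $ 0 = 0"
  shows "\<exists>r s. residue_class g (p * q) = residue_class g (r * fps_const var_x + s * fps_const var_y)"
proof -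
  let ?X = "fps_const var_x :: 'k fps fps fps" and ?Y = "fps_const var_y :: 'k fps fps fps"
  have split: "\<exists>P A B. p = var_z * P + ?X * A + ?Y * B" if "p $ 0 $ 0 $ 0 = 0" for p :: "'k fps fps fps"
  proof -
    obtain a b where "p $ 0 = var_x * a + var_y * b" using in_ideal_xy_decomp \<open>p $ 0 $ 0 $ 0 = 0\<close> by blast
    then have "fps_const (p $ 0) = ?X * fps_const a + ?Y * fps_const b" by simp
    moreover have "p = var_z * fps_shift 1 p + fps_const (p $ 0)" by (auto simp: fps_eq_iff var_z_def)
    ultimately show ?thesis by (metis add.assoc)
  qed
  obtain P A B where p: "p = var_z * P + ?X * A + ?Y * B" using split assms(1) by blast
  obtain Q C D where q: "q = var_z * Q + ?X * C + ?Y * D" using split assms(2) by blast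
  obtain a b where "g = var_x * a + var_y * b" using in_ideal_xy_decomp g0 by blast
  then have g_eq: "fps_const g = ?X * fps_const a + ?Y * fps_const b" by simp
  \<comment> \<open>Expand p q and replace z^2 P Q by - g P Q: these are the resulting coefficients
    of x and y, with a and b coming from g = x a + y b.\<close>
  let ?r = "A * q + var_z * P * C - P * Q * fps_const a" and ?s = "B * q + var_z * P * D - P * Q * fps_const b"
  have "p * q - (?r * ?X + ?s * ?Y) = (var_z ^ 2 + fps_const g) * (P * Q)"
  proof -
    have "(Z * P + U * A + V * B) * q' -
        ((A * q' + Z * P * C - P * Q * a') * U + (B * q' + Z * P * D - P * Q * b') * V) =
        (Z ^ 2 + (U * a' + V * b')) * (P * Q)"
      if "q' = Z * Q + U * C + V * D" for Z U V a' b' q' :: "'k fps fps fps"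
      unfolding that by (simp add: algebra_simps power2_eq_square)
    from this[OF q] show ?thesis unfolding g_eq p .
  qed
  then have "residue_class g (p * q) = residue_class g (?r * ?X + ?s * ?Y)"
    unfolding residue_class_eq_iff by (metis dvd_triv_left)
  then show ?thesis by blast
qed

end

end

text \<open>In the cokernel, multiplication by z agrees with \<phi>. Writing \<phi> = x \<alpha> + y
  \<beta> entrywise, \<open>b1\<close> and \<open>b2\<close> are the images of \<alpha> v and
  \<beta> v for a preimage v of b.\<close>

lemma matrix_cokernel_z_smult:
  fixes g :: "'k::field fps fps" and M :: "('k fps fps fps set, 'b) module"
  assumes M: "module (hypersurface_ring g) M" and \<phi>: "\<phi> \<in> carrier_mat n n"
    and \<phi>_xy: "\<forall>i<n. \<forall>j<n. \<phi> $$ (i, j) \<in> ideal_xy"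
    and coker: "is_matrix_cokernel (hypersurface_ring g) n (z_minus g n \<phi>) M"
    and b: "b \<in> carrier M"
  shows "\<exists>b1\<in>carrier M. \<exists>b2\<in>carrier M. residue_class g var_z \<odot>\<^bsub>M\<^esub> b =
    residue_class g (fps_const var_x) \<odot>\<^bsub>M\<^esub> b1 \<oplus>\<^bsub>M\<^esub> residue_class g (fps_const var_y) \<odot>\<^bsub>M\<^esub> b2"
proof -
  let ?R = "hypersurface_ring g" and ?rc = "residue_class g"
  let ?F = "free_module ?R n"
  interpret M: module ?R M by (rule M)
  note rc = residue_class_in_carrier[of g]
  obtain \<pi> where \<pi>: "\<pi> \<in> mod_hom ?R ?F M" "\<pi> ` carrier ?F = carrier M"
    "mod_ker ?F M \<pi> = matrix_map ?R (z_minus g n \<phi>) ` carrier ?F"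
    using coker by (auto simp: is_matrix_cokernel_def)
  \<comment> \<open>Vectors over R are lifted to families of power series, so that the matrix
    computation takes place in k[[x,y,z]].\<close>
  define vv where "vv f = vec n (\<lambda>i. ?rc (f i))" for f
  have vv: "vv f \<in> carrier ?F" for f by (simp add: vv_def free_module_def rc)
  have vv_add: "vv f \<oplus>\<^bsub>?F\<^esub> vv h = vv (\<lambda>i. f i + h i)" for f h
    by (auto simp: vv_def free_module_def residue_class_ops)
  have vv_smult: "?rc p \<odot>\<^bsub>?F\<^esub> vv f = vv (\<lambda>i. p * f i)" for p f
    by (auto simp: vv_def free_module_def residue_class_ops)
  obtain v where v: "v \<in> carrier ?F" "b = \<pi> v" using \<pi>(2) b by blast
  have "\<exists>p. vec_index v i = ?rc p" if "i < n" for i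
    using v(1) that by (auto simp: free_module_def hypersurface_ring_carrier)
  then obtain f where f: "\<And>i. i < n \<Longrightarrow> vec_index v i = ?rc (f i)" by metis
  then have v_eq: "v = vv f" using v(1) by (auto simp: vv_def free_module_def)
  have "\<exists>ab. \<phi> $$ (i, j) = var_x * fst ab + var_y * snd ab" if "i < n" "j < n" for i j
    using ideal_xy_decomp \<phi>_xy that by fastforce
  then obtain ab where ab: "\<And>i j. i < n \<Longrightarrow> j < n \<Longrightarrow> \<phi> $$ (i, j) = var_x * fst (ab i j) + var_y * snd (ab i j)"
    by metis
  \<comment> \<open>The products \<alpha> f and \<beta> f for the splitting \<phi> = x \<alpha> + y
    \<beta>.\<close>
  define f1 where "f1 i = (\<Sum>j<n. fps_const (fst (ab i j)) * f j)" for i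
  define f2 where "f2 i = (\<Sum>j<n. fps_const (snd (ab i j)) * f j)" for i
  let ?X = "fps_const var_x :: 'k fps fps fps" and ?Y = "fps_const var_y :: 'k fps fps fps"
  have mat: "matrix_map ?R (z_minus g n \<phi>) v = vv (\<lambda>i. var_z * f i - (?X * f1 i + ?Y * f2 i))"
  proof (rule eq_vecI)
    fix i assume "i < dim_vec (vv (\<lambda>i. var_z * f i - (?X * f1 i + ?Y * f2 i)))"
    then have i: "i < n" by (simp add: vv_def)
    let ?e = "\<lambda>j. var_z * (if i = j then 1 else 0) - fps_const (\<phi> $$ (i, j))"
    have "vec_index (matrix_map ?R (z_minus g n \<phi>) v) i = (\<Oplus>\<^bsub>?R\<^esub>j\<in>{..<n}. ?rc (?e j * f j))"
    proof -
      have "vec_index (matrix_map ?R (z_minus g n \<phi>) v) i =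
          (\<Oplus>\<^bsub>?R\<^esub>j\<in>{..<n}. z_minus g n \<phi> $$ (i, j) \<otimes>\<^bsub>?R\<^esub> vec_index v j)"
        using i \<phi> by (simp add: matrix_map_def z_minus_def)
      also have "\<dots> = (\<Oplus>\<^bsub>?R\<^esub>j\<in>{..<n}. ?rc (?e j * f j))"
      proof (rule M.R.finsum_cong')
        fix j assume "j \<in> {..<n}"
        then have "z_minus g n \<phi> $$ (i, j) = ?rc (?e j)" "vec_index v j = ?rc (f j)"
          using i \<phi> f by (auto simp: z_minus_def)
        then show "z_minus g n \<phi> $$ (i, j) \<otimes>\<^bsub>?R\<^esub> vec_index v j = ?rc (?e j * f j)"
          by (simp only: residue_class_ops)
      qed (simp_all add: rc)
      finally show ?thesis .
    qed
    also have "\<dots> = ?rc (\<Sum>j<n. ?e j * f j)" by (simp add: residue_class_sum)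
    also have "(\<Sum>j<n. ?e j * f j) = (\<Sum>j<n. (if i = j then var_z * f j else 0)) - (\<Sum>j<n. fps_const (\<phi> $$ (i, j)) * f j)"
      unfolding sum_subtractf[symmetric] by (rule sum.cong) (auto simp: algebra_simps)
    also have "(\<Sum>j<n. (if i = j then var_z * f j else 0)) = var_z * f i" using i by simp
    also have "(\<Sum>j<n. fps_const (\<phi> $$ (i, j)) * f j) = ?X * f1 i + ?Y * f2 i"
      unfolding f1_def f2_def sum_distrib_left sum.distrib[symmetric]
    proof (rule sum.cong)
      fix j assume "j \<in> {..<n}"
      then have "fps_const (\<phi> $$ (i, j)) = ?X * fps_const (fst (ab i j)) + ?Y * fps_const (snd (ab i j))"
        using ab[OF i] by simp
      then show "fps_const (\<phi> $$ (i, j)) * f j = ?X * (fps_const (fst (ab i j)) * f j) + ?Y * (fps_const (snd (ab i j)) * f j)"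
        by (simp only: distrib_right mult.assoc)
    qed simp
    finally show "vec_index (matrix_map ?R (z_minus g n \<phi>) v) i = vec_index (vv (\<lambda>i. var_z * f i - (?X * f1 i + ?Y * f2 i))) i"
      using i by (simp add: vv_def)
  qed (use \<phi> in \<open>simp add: matrix_map_def z_minus_def vv_def\<close>)
  have "vv (\<lambda>i. var_z * f i - (?X * f1 i + ?Y * f2 i)) \<in> mod_ker ?F M \<pi>"
    unfolding \<pi>(3) mat[symmetric] using v(1) by blast
  then have ker: "\<pi> (vv (\<lambda>i. var_z * f i - (?X * f1 i + ?Y * f2 i))) = \<zero>\<^bsub>M\<^esub>" by (simp add: mod_ker_def)
  have \<pi>c: "\<pi> (vv h) \<in> carrier M" for h using mod_homD(1)[OF \<pi>(1) vv] .
  have \<pi>_add: "\<pi> (vv (\<lambda>i. h i + h' i)) = \<pi> (vv h) \<oplus>\<^bsub>M\<^esub> \<pi> (vv h')" for h h'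
    using mod_homD(2)[OF \<pi>(1) vv[of h] vv[of h']] by (simp add: vv_add)
  have \<pi>_smult: "\<pi> (vv (\<lambda>i. p * h i)) = ?rc p \<odot>\<^bsub>M\<^esub> \<pi> (vv h)" for p h
    using mod_homD(3)[OF \<pi>(1) rc[of p] vv[of h]] by (simp add: vv_smult)
  \<comment> \<open>Subtract and add \<phi> f: the difference z f - \<phi> f is in the image of the
    matrix z - \<phi> and dies in M.\<close>
  have "?rc var_z \<odot>\<^bsub>M\<^esub> b = \<pi> (vv (\<lambda>i. (var_z * f i - (?X * f1 i + ?Y * f2 i)) + (?X * f1 i + ?Y * f2 i)))"
    unfolding v(2) v_eq \<pi>_smult[symmetric] by simp
  also have "\<dots> = \<pi> (vv (\<lambda>i. ?X * f1 i + ?Y * f2 i))"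
    unfolding \<pi>_add[of "\<lambda>i. var_z * f i - (?X * f1 i + ?Y * f2 i)"] ker using \<pi>c by simp
  also have "\<dots> = ?rc ?X \<odot>\<^bsub>M\<^esub> \<pi> (vv f1) \<oplus>\<^bsub>M\<^esub> ?rc ?Y \<odot>\<^bsub>M\<^esub> \<pi> (vv f2)"
    unfolding \<pi>_add \<pi>_smult ..
  finally show ?thesis using \<pi>c by blast
qed

theorem proposition5p7:
  fixes g :: "'k::field fps fps"
    and \<mm> :: "'k fps fps fps set set"
    and M :: "('k fps fps fps set, 'b) module"
    and \<phi> :: "'k fps fps mat"
    and n :: nat
    and I :: "nat \<Rightarrow> ('k fps fps fps set, 'c) module"
    and \<epsilon> :: "'k fps fps fps set \<Rightarrow> 'c"
    and \<delta> :: "nat \<Rightarrow> 'c \<Rightarrow> 'c"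
    and E :: "('k fps fps fps set, 'e) module"
    and \<iota> :: "'k fps fps fps set set \<Rightarrow> 'e"
  assumes "ADE_equation g"
    and "maximalideal \<mm> (hypersurface_ring g)"
    and "maximal_CM_module (hypersurface_ring g) \<mm> M"
    and "\<phi> \<in> carrier_mat n n"
    and "\<forall>i<n. \<forall>j<n. \<phi> $$ (i, j) \<in> ideal_xy"
    and "is_matrix_cokernel (hypersurface_ring g) n (z_minus g n \<phi>) M"
    and "injective_resolution (hypersurface_ring g) (regular_module (hypersurface_ring g)) I \<epsilon> \<delta>"
    and "injective_hull (hypersurface_ring g) (residue_module (hypersurface_ring g) \<mm>) E \<iota>"
  shows "\<not> cl_rational (hypersurface_ring g)
            (module_closure (hypersurface_ring g) M)
            (local_cohomology (hypersurface_ring g) \<mm> I \<delta> 2) E"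
proof -
  let ?R = "hypersurface_ring g" and ?rc = "residue_class g"
  let ?X = "fps_const var_x :: 'k fps fps fps" and ?Y = "fps_const var_y :: 'k fps fps fps"
  have g0: "g $ 0 $ 0 = 0" using assms(1) by (rule ADE_equation_const_coeff)
  have M: "module ?R M" using assms(3) by (simp add: maximal_CM_module_def)
  interpret R: cring ?R by (rule hypersurface_ring_cring)
  note rc = residue_class_in_carrier[of g]
  note ops = residue_class_ops[of g, symmetric] residue_class_pow[of g, symmetric]
  note \<mm> = maximalideal_hypersurface_ring[OF g0 assms(2)]
  \<comment> \<open>The elements x, y, z of the abstract statement are the residue classes of the
    variables; equations in R turn into divisibility by z^2 + g in k[[x,y,z]].\<close>
  show ?thesis
  proof (rule not_cl_rational_module_closure[where x = "?rc ?X" and y = "?rc ?Y" and z = "?rc var_z"])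
    fix U assume U: "U \<in> carrier ?R" "U \<notin> \<mm>"
    then obtain p where "U = ?rc p" by (auto simp: hypersurface_ring_carrier)
    then show "U \<in> Units ?R" using residue_class_unit U(2) unfolding \<mm> by blast
  next
    fix U V assume "U \<in> \<mm>" "V \<in> \<mm>"
    then obtain p q where pq: "U = ?rc p" "V = ?rc q" "p $ 0 $ 0 $ 0 = 0" "q $ 0 $ 0 $ 0 = 0"
      unfolding \<mm> by blast
    obtain r s where "?rc (p * q) = ?rc (r * ?X + s * ?Y)" using residue_class_mult_in_xy[OF g0 pq(3,4)] by blast
    then show "\<exists>r\<in>carrier ?R. \<exists>s\<in>carrier ?R. U \<otimes>\<^bsub>?R\<^esub> V = r \<otimes>\<^bsub>?R\<^esub> ?rc ?X \<oplus>\<^bsub>?R\<^esub> s \<otimes>\<^bsub>?R\<^esub> ?rc ?Y"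
      unfolding pq(1,2) by (intro bexI[OF _ rc[of r]] bexI[OF _ rc[of s]]) (simp only: ops)
  next
    fix U assume "U \<in> carrier ?R" and U: "U \<otimes>\<^bsub>?R\<^esub> ?rc ?X = \<zero>\<^bsub>?R\<^esub>"
    then obtain p where p: "U = ?rc p" by (auto simp: hypersurface_ring_carrier)
    have "var_z ^ 2 + fps_const g dvd ?X * p"
      using U unfolding p ops(2) by (simp add: residue_class_eq_zero_iff mult.commute)
    then show "U = \<zero>\<^bsub>?R\<^esub>" unfolding p residue_class_eq_zero_iff by (rule hyp_poly_dvd_X_mult_cancel)
  next
    fix U V assume "U \<in> carrier ?R" "V \<in> carrier ?R"
      and UV: "U \<otimes>\<^bsub>?R\<^esub> ?rc ?X \<oplus>\<^bsub>?R\<^esub> V \<otimes>\<^bsub>?R\<^esub> ?rc ?Y = \<zero>\<^bsub>?R\<^esub>"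
    then obtain r s where rs: "U = ?rc r" "V = ?rc s" by (auto simp: hypersurface_ring_carrier)
    \<comment> \<open>The sign of r changes because the divisibility lemma is stated for a
      difference.\<close>
    have "var_z ^ 2 + fps_const g dvd ?Y * s - ?X * (- r)"
      using UV unfolding rs ops(1,2) residue_class_eq_zero_iff by (simp add: algebra_simps)
    from hyp_poly_dvd_Y_mult_mod_X[OF g0 this] obtain q where "var_z ^ 2 + fps_const g dvd s - q * ?X"
      by (auto simp: mult.commute)
    then have "V = ?rc q \<otimes>\<^bsub>?R\<^esub> ?rc ?X" unfolding rs ops(2) residue_class_eq_iff .
    then show "\<exists>q\<in>carrier ?R. V = q \<otimes>\<^bsub>?R\<^esub> ?rc ?X" using rc by blast
  next
    fix N :: nat and U V assume "U \<in> carrier ?R" "V \<in> carrier ?R"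
    then obtain r s where rs: "U = ?rc r" "V = ?rc s" by (auto simp: hypersurface_ring_carrier)
    show "?rc ?Y [^]\<^bsub>?R\<^esub> Suc N \<otimes>\<^bsub>?R\<^esub> U \<noteq>
      ?rc var_z \<otimes>\<^bsub>?R\<^esub> (?rc ?X [^]\<^bsub>?R\<^esub> N \<otimes>\<^bsub>?R\<^esub> ?rc ?Y [^]\<^bsub>?R\<^esub> N) \<oplus>\<^bsub>?R\<^esub> ?rc ?X [^]\<^bsub>?R\<^esub> Suc N \<otimes>\<^bsub>?R\<^esub> V"
      unfolding rs ops(1,2,5) residue_class_eq_iff by (rule hyp_poly_not_dvd[OF g0])
  next
    show "?rc ?X \<in> \<mm>" "?rc ?Y \<in> \<mm>" unfolding \<mm> by (auto simp: var_x_def var_y_def)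
    show "\<exists>b1\<in>carrier M. \<exists>b2\<in>carrier M. ?rc var_z \<odot>\<^bsub>M\<^esub> b = ?rc ?X \<odot>\<^bsub>M\<^esub> b1 \<oplus>\<^bsub>M\<^esub> ?rc ?Y \<odot>\<^bsub>M\<^esub> b2"
      if "b \<in> carrier M" for b
      by (rule matrix_cokernel_z_smult[OF M assms(4-6) that])
  qed (fact rc M assms)+
qed

end
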